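(* Consider the controlled system, the functions $W_t$, $U_t$, $U_t^*$ and all assumptions specified in the context. Then for every $t=0,1,\ldots,T$, $$U^*_t(y)=W_t(y)\qquad\text{for all } y\in E_Y .$$ Moreover, let $\varphi^*=(\varphi^*_0,\ldots,\varphi^*_{T-1})$ be a policy consisting of Borel measurable maps $\varphi_t^*:E_Y\to A$ realizing the maxima in the recursion defining $W_t$, i.e. for all $t\in\{0,\ldots,T-1\}$ and $y=(x,c)\in E_Y$, $$W_t(y)=\inf_{\theta\in\tau(t,c)}\int_{E_Y}W_{t+1}(y')\,e^{\gamma\beta^t r_t(x,\varphi_t^*(y))}\,Q(dy'\mid t,y,\varphi_t^*(y),\theta).$$ Then $\varphi^*$ is adaptive robust-optimal, that is, with $\varphi^{t,*}=(\varphi^*_t,\ldots,\varphi^*_{T-1})$, $$U^*_t(y)=U_t(\varphi^{t,*},y)\qquad\text{for all } y\in E_Y,\ t=0,\ldots,T-1 .$$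
   Context: Setting. $T\in\mathbb N$ (with $T\ge 1$) is a finite horizon, $\mathbb N_0=\{0,1,2,\ldots\}$, $\mathcal T=\{0,\ldots,T\}$, $\mathcal T'=\{0,\ldots,T-1\}$. $\boldsymbol\Theta\subset\mathbb R^d$ is a non-empty compact parameter set, $A\subset\mathbb R^k$ is a non-empty finite set of control values, $\beta\in(0,1)$, $\gamma>0$. $Z=(Z_t)_{t\ge1}$ is an $\mathbb R^m$-valued process on a measurable space $(\Omega,\mathscr F)$ carrying a family of probability measures $\{\mathbb P_\theta,\theta\in\boldsymbol\Theta\}$; under $\mathbb P_\theta$ each $Z_t$ has a density $f_Z(\cdot;\theta)$ with respect to Lebesgue measure on $\mathbb R^m$ (not depending on $t$). Dynamics. $S:\mathbb R^n\times A\times\mathbb R^m\to\mathbb R^n$ is measurable; $R:\mathbb N_0\times\mathbb R^d\times\mathbb R^m\to\boldsymbol\Theta$ is measurable. The augmented state space is $E_Y=\mathbb R^n\times\boldsymbol\Theta$, with generic element $y=(x,c)$ and Borel $\sigma$-field $\mathcal E_Y$. Define $\mathbf G(t,y,a,z)=(S(x,a,z),R(t,c,z))\in E_Y$ and the kernel $$Q(B\mid t,y,a,\theta)=\mathbb P_\theta(\mathbf G(t,y,a,Z_{t+1})\in B)=\int_{\mathbb R^m}1_B(\mathbf G(t,y,a,z))f_Z(z;\theta)\,dz,\quad B\in\mathcal E_Y.$$ Confidence regions. For each $t\in\mathcal T'$, $\tau(t,\cdot):\mathbb R^d\to2^{\boldsymbol\Theta}$ is a measurable set-valued function with non-empty compact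 values, which is upper hemi-continuous: for any $c\in\boldsymbol\Theta$ and any open set $E$ with $\tau(t,c)\subset E\subset\boldsymbol\Theta$ (open relative to $\boldsymbol\Theta$) there is a neighbourhood $D$ of $c$ with $\tau(t,c')\subset E$ for all $c'\in D$. Rewards. For $t\in\mathcal T'$ and $a\in A$, $r_t(\cdot,a):\mathbb R^n\to\mathbb R_+$ is bounded and continuous; $r_T:\mathbb R^n\to\mathbb R_+$ is bounded and continuous; write $r_T(x,a)=r_T(x)$ (so that the control $\varphi_T$ appearing formally below is irrelevant). Standing assumptions. (i) $S(\cdot,a,z)$ is continuous for all $a,z$; (ii) $f_Z(z;\cdot)$ is continuous on $\boldsymbol\Theta$ for each $z$; (iii) $R(t,\cdot,\cdot)$ is continuous for each $t\in\mathcal T'$; (iv) for all $t\in\mathcal T'$, $a\in A$, $Q(dy'\mid t,y,a,\theta)$ is a Borel measurable stochastic kernel with respect to $(y,\theta)$. Strategies. All strategies are Markovian. $\mathcal A^t$ is the set of tuples $\varphi^t=(\varphi_t,\ldots,\varphi_{T-1})$ of Borel measurable maps $\varphi_k:E_Y\to A$. $\boldsymbol\Psi^t$ is the set of tuples $\psi^t=(\psi_t,\ldots,\psi_{T-1})$ of Borel measurable maps $\psi_k:E_Y\to\boldsymbol\Theta$ with $\psi_k(x,c)\in\tau(k,c)$ for all $(x,c)\in E_Y$. For $t\in\mathcal T'$, $y_t\in E_Y$, $\mathbb Q^{\varphi^t,\psi^t}_{y_t,t}$ is the probability measure on $E_Y^{T-t}$ (coordinates $Y_k=(X_k,C_k)$,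 $k=t+1,\ldots,T$) given by $$\mathbb Q^{\varphi^t,\psi^t}_{y_t,t}(B_{t+1}\times\cdots\times B_T)=\int_{B_{t+1}}\cdots\int_{B_T}\prod_{u=t+1}^TQ(dy_u\mid u-1,y_{u-1},\varphi_{u-1}(y_{u-1}),\psi_{u-1}(y_{u-1})),$$ and $\mathcal Q^{\varphi^t,\boldsymbol\Psi^t}_{y_t,t}=\{\mathbb Q^{\varphi^t,\psi^t}_{y_t,t}:\psi^t\in\boldsymbol\Psi^t\}$. Value functions. For $y=(x,c)\in E_Y$, $$U_t(\varphi^t,y)=e^{\gamma\beta^tr_t(x,\varphi_t(y))}\inf_{\mathbb Q\in\mathcal Q^{\varphi^t,\boldsymbol\Psi^t}_{y,t}}\mathbb E_{\mathbb Q}\,e^{\gamma\sum_{k=t+1}^T\beta^kr_k(X_k,\varphi_k(Y_k))},\quad t\in\mathcal T',$$ $$U_t^*(y)=\sup_{\varphi^t\in\mathcal A^t}U_t(\varphi^t,y)\ (t\in\mathcal T'),\qquad U_T^*(y)=e^{\gamma\beta^Tr_T(x)}.$$ Adaptive robust Bellman equations. $W_T(y)=e^{\gamma\beta^Tr_T(x)}$ and, for $t=T-1,\ldots,0$, $$W_t(y)=\max_{a\in A}\inf_{\theta\in\tau(t,c)}\int_{E_Y}W_{t+1}(y')e^{\gamma\beta^tr_t(x,a)}\,Q(dy'\mid t,y,a,\theta),\quad y=(x,c)\in E_Y.$$ The functions $W_t$ are lower semi-continuous, and Borel measurable maps realizing the maxima exist (proved separately in the paper). *)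

theory Defs
  imports "HOL-Probability.Probability"
begin

record ('n, 'd, 'k, 'm, 'w) robust_model =
  horizon :: nat
  params :: "(real^'d) set"
  controls :: "(real^'k) set"
  discount :: real
  risk :: real
  events :: "'w measure"
  prob_law :: "real^'d \<Rightarrow> 'w measure"
  noise :: "nat \<Rightarrow> 'w \<Rightarrow> real^'m"
  noise_density :: "real^'m \<Rightarrow> real^'d \<Rightarrow> real"
  dyn :: "real^'n \<Rightarrow> real^'k \<Rightarrow> real^'m \<Rightarrow> real^'n"
  estim :: "nat \<Rightarrow> real^'d \<Rightarrow> real^'m \<Rightarrow> real^'d"
  region :: "nat \<Rightarrow> real^'d \<Rightarrow> (real^'d) set"
  run_reward :: "nat \<Rightarrow> real^'n \<Rightarrow> real^'k \<Rightarrow> real"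
  end_reward :: "real^'n \<Rightarrow> real"

text \<open>In the paper's notation the fields are, in this order,
  $T$, $\Theta$, $A$, $\beta$, $\gamma$, the measurable space $(\Omega, F)$ (only the
  $\sigma$-algebra of \<open>events\<close> matters, not its measure), $P_\theta$, $Z_t$, $f_Z(z;\theta)$,
  $S$, $R$, $\tau$, $r_t$ for $t < T$, and $r_T$.\<close>

type_synonym ('n, 'd) state = "(real^'n) \<times> (real^'d)"

definition states :: "('n::finite, 'd::finite, 'k::finite, 'm::finite, 'w) robust_model \<Rightarrow> ('n, 'd) state set" where
  "states M = UNIV \<times> params M"

definition state_space :: "('n::finite, 'd::finite, 'k::finite, 'm::finite, 'w) robust_model \<Rightarrow> ('n, 'd) state measure" where
  "state_space M = restrict_space borel (states M)"

definition transition ::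
  "('n::finite, 'd::finite, 'k::finite, 'm::finite, 'w) robust_model \<Rightarrow> nat \<Rightarrow> ('n, 'd) state \<Rightarrow> real^'k \<Rightarrow> real^'m
    \<Rightarrow> ('n, 'd) state" where
  "transition M t y a z = (dyn M (fst y) a z, estim M t (snd y) z)"

definition Q_kernel ::
  "('n::finite, 'd::finite, 'k::finite, 'm::finite, 'w) robust_model \<Rightarrow> nat \<Rightarrow> ('n, 'd) state \<Rightarrow> real^'k \<Rightarrow> real^'d
    \<Rightarrow> ('n, 'd) state measure" where
  "Q_kernel M t y a \<theta> =
     distr (prob_law M \<theta>) (state_space M) (\<lambda>\<omega>. transition M t y a (noise M (Suc t) \<omega>))"

definition measurable_set_valued :: "('a::topological_space \<Rightarrow> 'b::topological_space set) \<Rightarrow> bool" where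
  "measurable_set_valued F \<longleftrightarrow> (\<forall>C. closed C \<longrightarrow> {c. F c \<inter> C \<noteq> {}} \<in> sets borel)"

definition upper_hemicontinuous_on ::
  "'a::topological_space set \<Rightarrow> ('a \<Rightarrow> 'a set) \<Rightarrow> bool" where
  "upper_hemicontinuous_on \<Theta> F \<longleftrightarrow>
     (\<forall>c\<in>\<Theta>. \<forall>E. openin (top_of_set \<Theta>) E \<and> F c \<subseteq> E \<longrightarrow>
        (\<exists>D. open D \<and> c \<in> D \<and> (\<forall>c'\<in>D. F c' \<subseteq> E)))"

locale adaptive_robust =
  fixes M :: "('n::finite, 'd::finite, 'k::finite, 'm::finite, 'w) robust_model"
  assumes horizon_ge_1: "1 \<le> horizon M"
    and params_compact: "compact (params M)"
    and params_nonempty: "params M \<noteq> {}"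
    and controls_finite: "finite (controls M)"
    and controls_nonempty: "controls M \<noteq> {}"
    and discount_pos: "0 < discount M"
    and discount_less_1: "discount M < 1"
    and risk_pos: "0 < risk M"
    and prob_law_prob: "\<And>\<theta>. \<theta> \<in> params M \<Longrightarrow> prob_space (prob_law M \<theta>)"
    and prob_law_sets: "\<And>\<theta>. \<theta> \<in> params M \<Longrightarrow> sets (prob_law M \<theta>) = sets (events M)"
    and noise_measurable: "\<And>t. 1 \<le> t \<Longrightarrow> noise M t \<in> events M \<rightarrow>\<^sub>M borel"
    and noise_density_nonneg: "\<And>z \<theta>. \<theta> \<in> params M \<Longrightarrow> 0 \<le> noise_density M z \<theta>"
    and noise_distributed: "\<And>t \<theta>. 1 \<le> t \<Longrightarrow> \<theta> \<in> params M \<Longrightarrow>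
          distributed (prob_law M \<theta>) lborel (noise M t) (\<lambda>z. ennreal (noise_density M z \<theta>))"
    and dyn_measurable: "(\<lambda>(x, a, z). dyn M x a z)
          \<in> borel_measurable (restrict_space borel (UNIV \<times> controls M \<times> UNIV))"
    and estim_measurable: "(\<lambda>(t, c, z). estim M t c z)
          \<in> count_space UNIV \<Otimes>\<^sub>M (borel \<Otimes>\<^sub>M borel) \<rightarrow>\<^sub>M restrict_space borel (params M)"
    and region_subset: "\<And>t c. t < horizon M \<Longrightarrow> region M t c \<subseteq> params M"
    and region_nonempty: "\<And>t c. t < horizon M \<Longrightarrow> region M t c \<noteq> {}"
    and region_compact: "\<And>t c. t < horizon M \<Longrightarrow> compact (region M t c)"
    and region_measurable: "\<And>t. t < horizon M \<Longrightarrow> measurable_set_valued (region M t)"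
    and region_uhc: "\<And>t. t < horizon M \<Longrightarrow> upper_hemicontinuous_on (params M) (region M t)"
    and run_reward_nonneg: "\<And>t x a. t < horizon M \<Longrightarrow> a \<in> controls M \<Longrightarrow> 0 \<le> run_reward M t x a"
    and run_reward_bounded: "\<And>t a. t < horizon M \<Longrightarrow> a \<in> controls M \<Longrightarrow>
          bounded (range (\<lambda>x. run_reward M t x a))"
    and run_reward_continuous: "\<And>t a. t < horizon M \<Longrightarrow> a \<in> controls M \<Longrightarrow>
          continuous_on UNIV (\<lambda>x. run_reward M t x a)"
    and end_reward_nonneg: "\<And>x. 0 \<le> end_reward M x"
    and end_reward_bounded: "bounded (range (end_reward M))"
    and end_reward_continuous: "continuous_on UNIV (end_reward M)"
    and dyn_continuous: "\<And>a z. a \<in> controls M \<Longrightarrow> continuous_on UNIV (\<lambda>x. dyn M x a z)"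
    and noise_density_continuous: "\<And>z. continuous_on (params M) (noise_density M z)"
    and estim_continuous: "\<And>t. t < horizon M \<Longrightarrow> continuous_on UNIV (\<lambda>(c, z). estim M t c z)"
    and Q_kernel_measurable: "\<And>t a. t < horizon M \<Longrightarrow> a \<in> controls M \<Longrightarrow>
          (\<lambda>(y, \<theta>). Q_kernel M t y a \<theta>)
            \<in> state_space M \<Otimes>\<^sub>M restrict_space borel (params M) \<rightarrow>\<^sub>M prob_algebra (state_space M)"

definition control_strategies ::
  "('n::finite, 'd::finite, 'k::finite, 'm::finite, 'w) robust_model \<Rightarrow> nat \<Rightarrow> (nat \<Rightarrow> ('n, 'd) state \<Rightarrow> real^'k) set" where
  "control_strategies M t =
     (\<Pi>\<^sub>E k\<in>{t..<horizon M}. state_space M \<rightarrow>\<^sub>M restrict_space borel (controls M))"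

definition nature_strategies ::
  "('n::finite, 'd::finite, 'k::finite, 'm::finite, 'w) robust_model \<Rightarrow> nat \<Rightarrow> (nat \<Rightarrow> ('n, 'd) state \<Rightarrow> real^'d) set" where
  "nature_strategies M t =
     {\<psi> \<in> \<Pi>\<^sub>E k\<in>{t..<horizon M}. state_space M \<rightarrow>\<^sub>M restrict_space borel (params M).
        \<forall>k\<in>{t..<horizon M}. \<forall>(x, c)\<in>states M. \<psi> k (x, c) \<in> region M k c}"

text \<open>\<open>path_steps M \<phi> \<psi> n t y\<close> is the law of $(Y_{t+1}, \dots, Y_{t+n})$ started in
  $Y_t = y$. Lemma \<open>path_law_rectangle\<close> below shows that on rectangles it is the
  iterated integral of the kernels.\<close>

primrec path_steps ::
  "('n::finite, 'd::finite, 'k::finite, 'm::finite, 'w) robust_model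
    \<Rightarrow> (nat \<Rightarrow> ('n, 'd) state \<Rightarrow> real^'k) \<Rightarrow> (nat \<Rightarrow> ('n, 'd) state \<Rightarrow> real^'d)
    \<Rightarrow> nat \<Rightarrow> nat \<Rightarrow> ('n, 'd) state \<Rightarrow> (nat \<Rightarrow> ('n, 'd) state) measure" where
  "path_steps M \<phi> \<psi> 0 t y = return (\<Pi>\<^sub>M k\<in>{}. state_space M) (\<lambda>_. undefined)"
| "path_steps M \<phi> \<psi> (Suc n) t y =
     Q_kernel M t y (\<phi> t y) (\<psi> t y) \<bind>
       (\<lambda>y'. distr (path_steps M \<phi> \<psi> n (Suc t) y')
               (\<Pi>\<^sub>M k\<in>{t<..t + Suc n}. state_space M) (\<lambda>\<omega>. fun_upd \<omega> (Suc t) y'))"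

definition path_law ::
  "('n::finite, 'd::finite, 'k::finite, 'm::finite, 'w) robust_model \<Rightarrow> nat
    \<Rightarrow> (nat \<Rightarrow> ('n, 'd) state \<Rightarrow> real^'k) \<Rightarrow> (nat \<Rightarrow> ('n, 'd) state \<Rightarrow> real^'d)
    \<Rightarrow> ('n, 'd) state \<Rightarrow> (nat \<Rightarrow> ('n, 'd) state) measure" where
  "path_law M t \<phi> \<psi> y = path_steps M \<phi> \<psi> (horizon M - t) t y"

definition path_laws ::
  "('n::finite, 'd::finite, 'k::finite, 'm::finite, 'w) robust_model \<Rightarrow> nat
    \<Rightarrow> (nat \<Rightarrow> ('n, 'd) state \<Rightarrow> real^'k) \<Rightarrow> ('n, 'd) state \<Rightarrow> (nat \<Rightarrow> ('n, 'd) state) measure set" where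
  "path_laws M t \<phi> y = (\<lambda>\<psi>. path_law M t \<phi> \<psi> y) ` nature_strategies M t"

definition reward ::
  "('n::finite, 'd::finite, 'k::finite, 'm::finite, 'w) robust_model \<Rightarrow> nat \<Rightarrow> real^'n \<Rightarrow> real^'k \<Rightarrow> real" where
  "reward M t x a = (if t = horizon M then end_reward M x else run_reward M t x a)"

definition U_value ::
  "('n::finite, 'd::finite, 'k::finite, 'm::finite, 'w) robust_model \<Rightarrow> nat
    \<Rightarrow> (nat \<Rightarrow> ('n, 'd) state \<Rightarrow> real^'k) \<Rightarrow> ('n, 'd) state \<Rightarrow> real" where
  "U_value M t \<phi> y =
     exp (risk M * discount M ^ t * reward M t (fst y) (\<phi> t y)) *
     (INF \<Q>\<in>path_laws M t \<phi> y.
        \<integral>\<omega>. exp (risk M * (\<Sum>k\<in>{t<..horizon M}. discount M ^ k * reward M k (fst (\<omega> k)) (\<phi> k (\<omega> k)))) \<partial>\<Q>)"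

definition U_opt ::
  "('n::finite, 'd::finite, 'k::finite, 'm::finite, 'w) robust_model \<Rightarrow> nat \<Rightarrow> ('n, 'd) state \<Rightarrow> real" where
  "U_opt M t y =
     (if t < horizon M then (SUP \<phi>\<in>control_strategies M t. U_value M t \<phi> y)
      else exp (risk M * discount M ^ horizon M * end_reward M (fst y)))"

definition bellman_inf ::
  "('n::finite, 'd::finite, 'k::finite, 'm::finite, 'w) robust_model \<Rightarrow> nat
    \<Rightarrow> (('n, 'd) state \<Rightarrow> real) \<Rightarrow> ('n, 'd) state \<Rightarrow> real^'k \<Rightarrow> real" where
  "bellman_inf M t V y a =
     (INF \<theta>\<in>region M t (snd y).
        \<integral>y'. V y' * exp (risk M * discount M ^ t * reward M t (fst y) a) \<partial>Q_kernel M t y a \<theta>)"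

function W_value ::
  "('n::finite, 'd::finite, 'k::finite, 'm::finite, 'w) robust_model \<Rightarrow> nat \<Rightarrow> ('n, 'd) state \<Rightarrow> real" where
  "W_value M t y =
     (if t < horizon M then Max (bellman_inf M t (W_value M (Suc t)) y ` controls M)
      else exp (risk M * discount M ^ horizon M * end_reward M (fst y)))"
  by pat_completeness auto
termination
  by (relation "Wellfounded.measure (\<lambda>(M, t, y). horizon M - t)") auto

declare W_value.simps [simp del]

lemma space_state_space: "space (state_space M) = states M"
  by (simp add: state_space_def space_restrict_space)

context adaptive_robust
begin

lemma transition_measurable:
  assumes t: "t < horizon M" and y: "y \<in> states M" and a: "a \<in> controls M"
  shows "transition M t y a \<in> borel \<rightarrow>\<^sub>M state_space M"
proof -
  have "(\<lambda>z. (fst y, a, z)) \<in> borel \<rightarrow>\<^sub>M restrict_space borel (UNIV \<times> controls M \<times> UNIV)"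
    using a by (intro measurable_restrict_space2) (auto intro!: borel_measurable_continuous_onI continuous_intros)
  from measurable_compose[OF this dyn_measurable]
  have 1: "(\<lambda>z. dyn M (fst y) a z) \<in> borel_measurable borel"
    by simp
  have "(\<lambda>z. (t, snd y, z)) \<in> borel \<rightarrow>\<^sub>M count_space UNIV \<Otimes>\<^sub>M (borel \<Otimes>\<^sub>M borel)"
    by measurable
  from measurable_compose[OF this estim_measurable]
  have 2: "(\<lambda>z. estim M t (snd y) z) \<in> borel \<rightarrow>\<^sub>M restrict_space borel (params M)"
    by simp
  then have 3: "estim M t (snd y) z \<in> params M" for z
    by (auto simp: measurable_restrict_space2_iff)
  from 2 have 4: "(\<lambda>z. estim M t (snd y) z) \<in> borel_measurable borel"
    by (auto simp: measurable_restrict_space2_iff)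
  show ?thesis
    unfolding state_space_def states_def
    using 1 3 4 by (intro measurable_restrict_space2) (auto simp: transition_def[abs_def])
qed

lemma Q_kernel_density:
  assumes "t < horizon M" "y \<in> states M" "a \<in> controls M" "\<theta> \<in> params M" "B \<in> sets (state_space M)"
  shows "emeasure (Q_kernel M t y a \<theta>) B =
    (\<integral>\<^sup>+z. indicator B (transition M t y a z) * ennreal (noise_density M z \<theta>) \<partial>lborel)"
proof -
  note D = noise_distributed[of "Suc t" \<theta>, simplified, OF assms(4)]
  note [measurable] = transition_measurable[OF assms(1-3)] assms(5)
  have tr [measurable]: "transition M t y a \<in> lborel \<rightarrow>\<^sub>M state_space M"
    by simp
  have f [measurable]: "(\<lambda>z. ennreal (noise_density M z \<theta>)) \<in> borel_measurable lborel"
    using D by (simp add: distributed_def)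
  have Z [measurable]: "noise M (Suc t) \<in> prob_law M \<theta> \<rightarrow>\<^sub>M lborel"
    using D by (simp add: distributed_def)
  have "Q_kernel M t y a \<theta> =
      distr (distr (prob_law M \<theta>) lborel (noise M (Suc t))) (state_space M) (transition M t y a)"
    unfolding Q_kernel_def by (subst distr_distr[OF tr Z]) (simp add: comp_def)
  also have "distr (prob_law M \<theta>) lborel (noise M (Suc t)) =
      density lborel (\<lambda>z. ennreal (noise_density M z \<theta>))"
    using D by (simp add: distributed_def)
  finally have eq: "Q_kernel M t y a \<theta> = distr (density lborel (\<lambda>z. ennreal (noise_density M z \<theta>)))
      (state_space M) (transition M t y a)" .
  have "emeasure (Q_kernel M t y a \<theta>) B =
      (\<integral>\<^sup>+y'. indicator B y' \<partial>Q_kernel M t y a \<theta>)"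
    by (rule nn_integral_indicator[symmetric]) (simp add: Q_kernel_def)
  also have "\<dots> = (\<integral>\<^sup>+z. indicator B (transition M t y a z) \<partial>density lborel (\<lambda>z. ennreal (noise_density M z \<theta>)))"
    unfolding eq by (subst nn_integral_distr) auto
  also have "\<dots> = (\<integral>\<^sup>+z. ennreal (noise_density M z \<theta>) * indicator B (transition M t y a z) \<partial>lborel)"
    by (subst nn_integral_density) auto
  finally show ?thesis
    by (simp add: mult.commute)
qed

lemma strategy_kernel_measurable:
  assumes t: "t < horizon M"
    and f: "f \<in> state_space M \<rightarrow>\<^sub>M restrict_space borel (controls M)"
    and g: "g \<in> state_space M \<rightarrow>\<^sub>M restrict_space borel (params M)"
  shows "(\<lambda>y. Q_kernel M t y (f y) (g y)) \<in> state_space M \<rightarrow>\<^sub>M prob_algebra (state_space M)"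
proof (rule measurable_compose_countable'[where I = "controls M" and g = f
    and f = "\<lambda>a y. Q_kernel M t y a (g y)"])
  show "countable (controls M)"
    using controls_finite by (rule countable_finite)
  show "(\<lambda>y. Q_kernel M t y a (g y)) \<in> state_space M \<rightarrow>\<^sub>M prob_algebra (state_space M)"
    if "a \<in> controls M" for a
    using measurable_compose[OF measurable_Pair[OF measurable_ident g] Q_kernel_measurable[OF t that]]
    by simp
  have "f -` {a} \<inter> space (state_space M) \<in> sets (state_space M)" for a
    using measurable_sets[of f "state_space M" borel "{a}"] f
    by (auto simp: measurable_restrict_space2_iff)
  moreover have "f \<in> space (state_space M) \<rightarrow> controls M"
    using f by (auto simp: measurable_restrict_space2_iff)
  ultimately show "f \<in> state_space M \<rightarrow>\<^sub>M count_space (controls M)"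
    using controls_finite
    by (simp add: measurable_count_space_eq2)
qed

lemma path_steps_measurable:
  assumes "t + n \<le> horizon M"
    and "\<And>k. k \<in> {t..<horizon M} \<Longrightarrow> \<phi> k \<in> state_space M \<rightarrow>\<^sub>M restrict_space borel (controls M)"
    and "\<And>k. k \<in> {t..<horizon M} \<Longrightarrow> \<psi> k \<in> state_space M \<rightarrow>\<^sub>M restrict_space borel (params M)"
  shows "path_steps M \<phi> \<psi> n t \<in> state_space M \<rightarrow>\<^sub>M prob_algebra (\<Pi>\<^sub>M k\<in>{t<..t + n}. state_space M)"
  using assms
proof (induction n arbitrary: t)
  case 0
  have "return (\<Pi>\<^sub>M k\<in>{}. state_space M) (\<lambda>_. undefined) \<in> space (prob_algebra (\<Pi>\<^sub>M k\<in>{}. state_space M))"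
    by (auto simp: space_prob_algebra space_PiM intro!: prob_space_return)
  then show ?case
    by simp
next
  case (Suc n)
  have IH: "path_steps M \<phi> \<psi> n (Suc t)
      \<in> state_space M \<rightarrow>\<^sub>M prob_algebra (\<Pi>\<^sub>M k\<in>{Suc t<..Suc t + n}. state_space M)"
    using Suc.prems by (intro Suc.IH) auto
  have ins: "{t<..t + Suc n} = insert (Suc t) {Suc t<..Suc t + n}"
    by auto
  have upd: "(\<lambda>(y', \<omega>). fun_upd \<omega> (Suc t) y') \<in> state_space M \<Otimes>\<^sub>M (\<Pi>\<^sub>M k\<in>{Suc t<..Suc t + n}. state_space M)
      \<rightarrow>\<^sub>M (\<Pi>\<^sub>M k\<in>{t<..t + Suc n}. state_space M)"
    unfolding ins split_beta' by (rule measurable_fun_upd[where J = "{Suc t<..Suc t + n}"]) auto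
  have k: "(\<lambda>y. Q_kernel M t y (\<phi> t y) (\<psi> t y)) \<in> state_space M \<rightarrow>\<^sub>M prob_algebra (state_space M)"
    using Suc.prems by (intro strategy_kernel_measurable) auto
  show ?case
    unfolding path_steps.simps
    by (intro measurable_bind_prob_space[OF k] measurable_distr_prob_space2[OF IH upd])
qed

lemma path_law_prob:
  assumes "t \<le> horizon M" "y \<in> states M" "\<phi> \<in> control_strategies M t" "\<psi> \<in> nature_strategies M t"
  shows "path_law M t \<phi> \<psi> y \<in> space (prob_algebra (\<Pi>\<^sub>M k\<in>{t<..horizon M}. state_space M))"
  using measurable_space[OF path_steps_measurable[of t "horizon M - t" \<phi> \<psi>], of y] assms
  by (auto simp: path_law_def space_state_space control_strategies_def nature_strategies_def PiE_iff)

lemma path_law_rectangle: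
  assumes t: "t < horizon M" and y: "y \<in> states M"
    and \<phi>: "\<phi> \<in> control_strategies M t" and \<psi>: "\<psi> \<in> nature_strategies M t"
    and B: "\<And>k. k \<in> {t<..horizon M} \<Longrightarrow> B k \<in> sets (state_space M)"
  shows "emeasure (path_law M t \<phi> \<psi> y) (\<Pi>\<^sub>E k\<in>{t<..horizon M}. B k) =
    (\<integral>\<^sup>+y'\<in>B (Suc t). emeasure (path_law M (Suc t) \<phi> \<psi> y') (\<Pi>\<^sub>E k\<in>{Suc t<..horizon M}. B k)
       \<partial>Q_kernel M t y (\<phi> t y) (\<psi> t y))"
proof -
  define n where "n = horizon M - Suc t"
  have T: "horizon M = Suc (t + n)" "horizon M - t = Suc n" "horizon M - Suc t = n"
    using t by (auto simp: n_def)
  have \<phi>': "\<phi> k \<in> state_space M \<rightarrow>\<^sub>M restrict_space borel (controls M)" if "k \<in> {t..<horizon M}" for k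
    using \<phi> that by (auto simp: control_strategies_def PiE_iff)
  have \<psi>': "\<psi> k \<in> state_space M \<rightarrow>\<^sub>M restrict_space borel (params M)" if "k \<in> {t..<horizon M}" for k
    using \<psi> that by (auto simp: nature_strategies_def PiE_iff)
  let ?I = "{Suc t<..Suc t + n}" and ?J = "{t<..t + Suc n}"
  let ?K = "Q_kernel M t y (\<phi> t y) (\<psi> t y)"
  have P: "path_steps M \<phi> \<psi> n (Suc t) \<in> state_space M \<rightarrow>\<^sub>M prob_algebra (\<Pi>\<^sub>M k\<in>?I. state_space M)"
    using T \<phi>' \<psi>' by (intro path_steps_measurable) auto
  have ins: "?J = insert (Suc t) ?I"
    by auto
  have upd: "(\<lambda>(y', \<omega>). fun_upd \<omega> (Suc t) y') \<in> state_space M \<Otimes>\<^sub>M (\<Pi>\<^sub>M k\<in>?I. state_space M)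
      \<rightarrow>\<^sub>M (\<Pi>\<^sub>M k\<in>?J. state_space M)"
    unfolding ins split_beta' by (rule measurable_fun_upd[where J = ?I]) auto
  have K: "?K \<in> space (prob_algebra (state_space M))"
    using measurable_space[OF strategy_kernel_measurable[OF t \<phi>' \<psi>'], of t t y] t y
    by (auto simp: space_state_space)
  then have setsK [measurable_cong]: "sets ?K = sets (state_space M)" and "prob_space ?K"
    by (auto simp: space_prob_algebra)
  have neK: "space ?K \<noteq> {}"
    using \<open>prob_space ?K\<close> by (rule prob_space.not_empty)
  have spK: "space ?K = space (state_space M)"
    using setsK by (rule sets_eq_imp_space_eq)
  have D: "(\<lambda>y'. distr (path_steps M \<phi> \<psi> n (Suc t) y') (\<Pi>\<^sub>M k\<in>?J. state_space M) (\<lambda>\<omega>. fun_upd \<omega> (Suc t) y'))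
      \<in> ?K \<rightarrow>\<^sub>M subprob_algebra (\<Pi>\<^sub>M k\<in>?J. state_space M)"
    using measurable_prob_algebraD[OF measurable_distr_prob_space2[OF P upd]]
    by (simp cong: measurable_cong_sets add: setsK)
  have BJ: "(\<Pi>\<^sub>E k\<in>?J. B k) \<in> sets (\<Pi>\<^sub>M k\<in>?J. state_space M)"
    using B T by (intro sets_PiM_I_finite) auto
  have "emeasure (path_law M t \<phi> \<psi> y) (\<Pi>\<^sub>E k\<in>{t<..horizon M}. B k) =
      (\<integral>\<^sup>+y'. emeasure (distr (path_steps M \<phi> \<psi> n (Suc t) y') (\<Pi>\<^sub>M k\<in>?J. state_space M)
         (\<lambda>\<omega>. fun_upd \<omega> (Suc t) y')) (\<Pi>\<^sub>E k\<in>?J. B k) \<partial>?K)"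
    unfolding path_law_def T path_steps.simps
    using emeasure_bind[OF neK D BJ] by simp
  also have "\<dots> = (\<integral>\<^sup>+y'\<in>B (Suc t). emeasure (path_steps M \<phi> \<psi> n (Suc t) y') (\<Pi>\<^sub>E k\<in>?I. B k) \<partial>?K)"
  proof (rule nn_integral_cong)
    fix y' assume "y' \<in> space ?K"
    then have y': "y' \<in> space (state_space M)"
      by (simp add: spK)
    let ?N = "path_steps M \<phi> \<psi> n (Suc t) y'"
    have setsN: "sets ?N = sets (\<Pi>\<^sub>M k\<in>?I. state_space M)"
      using measurable_space[OF P y'] by (simp add: space_prob_algebra)
    then have spN: "space ?N = (\<Pi>\<^sub>E k\<in>?I. states M)"
      by (simp add: sets_eq_imp_space_eq[OF setsN] space_PiM space_state_space)
    have u: "(\<lambda>\<omega>. fun_upd \<omega> (Suc t) y') \<in> ?N \<rightarrow>\<^sub>M (\<Pi>\<^sub>M k\<in>?J. state_space M)"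
      using measurable_compose[OF measurable_Pair1'[OF y'] upd]
      by (simp cong: measurable_cong_sets add: setsN)
    have sub: "B k \<subseteq> states M" if "k \<in> ?J" for k
      using sets.sets_into_space[OF B[of k]] that T by (auto simp: space_state_space)
    have pre: "(\<lambda>\<omega>. fun_upd \<omega> (Suc t) y') -` (\<Pi>\<^sub>E k\<in>?J. B k) \<inter> space ?N =
        (if y' \<in> B (Suc t) then (\<Pi>\<^sub>E k\<in>?I. B k) else {})"
    proof -
      have "fun_upd \<omega> (Suc t) y' \<in> (\<Pi>\<^sub>E k\<in>?J. B k) \<longleftrightarrow> y' \<in> B (Suc t) \<and> \<omega> \<in> (\<Pi>\<^sub>E k\<in>?I. B k)"
        if "\<omega> \<in> (\<Pi>\<^sub>E k\<in>?I. states M)" for \<omega>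
      proof -
        have "k \<noteq> Suc t" if "k \<in> ?I" for k
          using that by simp
        moreover have "\<omega> \<in> extensional ?I"
          using that by (simp add: PiE_iff)
        moreover have "fun_upd \<omega> (Suc t) y' \<in> extensional ?J"
          using \<open>\<omega> \<in> extensional ?I\<close> unfolding ins by (simp add: extensional_def)
        ultimately show ?thesis
          unfolding PiE_iff unfolding ins by (simp del: greaterThanAtMost_iff)
      qed
      moreover have "(\<Pi>\<^sub>E k\<in>?I. B k) \<subseteq> (\<Pi>\<^sub>E k\<in>?I. states M)"
        using sub by (intro PiE_mono) auto
      ultimately show ?thesis
        unfolding spN by auto
    qed
    show "emeasure (distr ?N (\<Pi>\<^sub>M k\<in>?J. state_space M) (\<lambda>\<omega>. fun_upd \<omega> (Suc t) y')) (\<Pi>\<^sub>E k\<in>?J. B k) =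
        emeasure ?N (\<Pi>\<^sub>E k\<in>?I. B k) * indicator (B (Suc t)) y'"
      unfolding emeasure_distr[OF u BJ] pre by (simp add: indicator_def)
  qed
  finally show ?thesis
    by (simp add: path_law_def T)
qed

end

end

theory Submission
  imports Defs
begin

text \<open>By backward induction every \<open>W\<^sub>t\<close> is bounded and lower semicontinuous: by Fatou's lemma the
  one-step integral is lower semicontinuous jointly in state and parameter, an infimum over
  confidence regions with closed graph in a compact set preserves this, because projections along
  compact sets are closed, and the maximum is over finitely many controls. Lower semicontinuity also
  yields Borel selectors of minimising parameters. The payoff of a pair of strategies solves a linear
  backward recursion with monotone one-step operators, so it is compared with \<open>W\<^sub>t\<close> stage by stage:
  nature's minimising answer keeps it below \<open>W\<^sub>t\<close>, and a control attaining the Bellman maxima keeps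
  it above \<open>W\<^sub>t\<close> against every answer.\<close>

lemma ennreal_cINF:
  assumes "I \<noteq> {}" "bdd_below (f ` I)"
  shows "ennreal (INF i\<in>I. f i) = (INF i\<in>I. ennreal (f i))"
proof -
  have "continuous (at_right (Inf (f ` I))) ennreal"
    unfolding continuous_within by (intro tendsto_ennrealI tendsto_ident_at)
  then show ?thesis
    using continuous_at_Inf_mono[of ennreal "f ` I"] assms
    by (simp add: mono_def ennreal_leI image_image)
qed

lemma INF_mult_left_ennreal:
  fixes c :: ennreal
  assumes "I \<noteq> {}" "c < top"
  shows "c * (INF i\<in>I. f i) = (INF i\<in>I. c * f i)"
proof -
  have "continuous (at_right (Inf (f ` I))) ((*) c)"
    unfolding continuous_within using assms(2) by (intro ennreal_tendsto_cmult tendsto_ident_at)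
  then show ?thesis
    using continuous_at_Inf_mono[of "(*) c" "f ` I"] assms(1)
    by (simp add: mono_def mult_left_mono image_image)
qed

section \<open>Lower semicontinuity\<close>

definition lsc_on :: "'a::topological_space set \<Rightarrow> ('a \<Rightarrow> 'b::linorder) \<Rightarrow> bool" where
  "lsc_on S f \<longleftrightarrow> (\<forall>\<alpha>. closedin (top_of_set S) {x \<in> S. f x \<le> \<alpha>})"

lemma lsc_on_cong: "(\<And>x. x \<in> S \<Longrightarrow> f x = g x) \<Longrightarrow> lsc_on S f \<longleftrightarrow> lsc_on S g"
  unfolding lsc_on_def by (metis (mono_tags, lifting) Collect_cong)

lemma continuous_on_imp_lsc_on:
  fixes f :: "'a::topological_space \<Rightarrow> 'b::linorder_topology"
  assumes "continuous_on S f"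
  shows "lsc_on S f"
  unfolding lsc_on_def
  using continuous_closedin_preimage[OF assms, of "{..\<alpha>}" for \<alpha>] by (simp add: vimage_def Int_def)

lemma lsc_on_compose:
  assumes "lsc_on T f" "continuous_on S h" "h \<in> S \<rightarrow> T"
  shows "lsc_on S (\<lambda>x. f (h x))"
  unfolding lsc_on_def
proof
  fix \<alpha>
  have "closedin (top_of_set S) (S \<inter> h -` {y \<in> T. f y \<le> \<alpha>})"
    using assms by (intro continuous_closedin_preimage_gen) (auto simp: lsc_on_def)
  also have "S \<inter> h -` {y \<in> T. f y \<le> \<alpha>} = {x \<in> S. f (h x) \<le> \<alpha>}"
    using assms(3) by auto
  finally show "closedin (top_of_set S) {x \<in> S. f (h x) \<le> \<alpha>}" .
qed

lemma lsc_on_section: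
  assumes "lsc_on (S \<times> K) (\<lambda>(x, p). g x p)" "x \<in> S" "L \<subseteq> K"
  shows "lsc_on L (g x)"
proof -
  have "lsc_on L (\<lambda>p. (\<lambda>(x, p). g x p) (x, p))"
    using assms(2,3) by (intro lsc_on_compose[OF assms(1)]) (auto intro!: continuous_intros)
  then show ?thesis
    by simp
qed

lemma lsc_on_Max:
  assumes "finite I" "I \<noteq> {}" "\<And>i. i \<in> I \<Longrightarrow> lsc_on S (f i)"
  shows "lsc_on S (\<lambda>x. Max ((\<lambda>i. f i x) ` I))"
  unfolding lsc_on_def
proof
  fix \<alpha>
  have "{x \<in> S. Max ((\<lambda>i. f i x) ` I) \<le> \<alpha>} = (\<Inter>i\<in>I. {x \<in> S. f i x \<le> \<alpha>})"
    using assms(1,2) by auto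
  also have "closedin (top_of_set S) \<dots>"
    using assms by (intro closedin_INT) (auto simp: lsc_on_def)
  finally show "closedin (top_of_set S) {x \<in> S. Max ((\<lambda>i. f i x) ` I) \<le> \<alpha>}" .
qed

lemma lsc_on_ennreal_iff:
  assumes "\<And>x. x \<in> S \<Longrightarrow> 0 \<le> f x"
  shows "lsc_on S (\<lambda>x. ennreal (f x)) \<longleftrightarrow> lsc_on S f"
proof -
  have "closedin (top_of_set S) {x \<in> S. f x \<le> r}" if "lsc_on S (\<lambda>x. ennreal (f x))" for r
  proof (cases "0 \<le> r")
    case True
    have "closedin (top_of_set S) {x \<in> S. ennreal (f x) \<le> ennreal r}"
      using that by (simp only: lsc_on_def)
    with True show ?thesis
      by simp
  next
    case False
    then have "{x \<in> S. f x \<le> r} = {}"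
      using assms by force
    then show ?thesis
      by (simp only: closedin_empty)
  qed
  moreover have "closedin (top_of_set S) {x \<in> S. ennreal (f x) \<le> \<alpha>}" if "lsc_on S f" for \<alpha>
    using that by (cases \<alpha>) (simp_all add: lsc_on_def)
  ultimately show ?thesis
    by (auto simp only: lsc_on_def)
qed

lemma closedin_imp_sets_restrict_space:
  "closedin (top_of_set S) T \<Longrightarrow> T \<in> sets (restrict_space borel S)"
  unfolding closedin_closed sets_restrict_space using borel_closed by blast

lemma lsc_on_measurable:
  fixes f :: "'a::topological_space \<Rightarrow> 'b::{linorder_topology,second_countable_topology}"
  assumes "lsc_on S f"
  shows "f \<in> borel_measurable (restrict_space borel S)"
  using assms
  by (intro borel_measurableI_le closedin_imp_sets_restrict_space)
    (simp add: lsc_on_def space_restrict_space)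

lemma lsc_on_le_liminf:
  fixes f :: "'a::topological_space \<Rightarrow> 'b::complete_linorder"
  assumes "lsc_on S f" "x \<in> S" "\<And>n. X n \<in> S" "X \<longlonglongrightarrow> x"
  shows "f x \<le> liminf (\<lambda>n. f (X n))"
  unfolding le_Liminf_iff
proof (intro allI impI)
  fix \<alpha> assume "\<alpha> < f x"
  obtain C where C: "closed C" "{x \<in> S. f x \<le> \<alpha>} = S \<inter> C"
    using assms(1) by (auto simp: lsc_on_def closedin_closed)
  have "x \<notin> S \<inter> C"
    unfolding C(2)[symmetric] using \<open>\<alpha> < f x\<close> by (simp add: not_le)
  then have "x \<in> - C"
    using assms(2) by simp
  then have "\<forall>\<^sub>F n in sequentially. X n \<in> - C"
    using C(1) by (intro topological_tendstoD[OF assms(4)]) auto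
  then show "\<forall>\<^sub>F n in sequentially. \<alpha> < f (X n)"
    by eventually_elim (use C(2) assms(3) in \<open>auto simp flip: not_le\<close>)
qed

lemma lsc_onI_le_liminf:
  fixes f :: "'a::first_countable_topology \<Rightarrow> 'b::complete_linorder"
  assumes "\<And>x X. x \<in> S \<Longrightarrow> (\<And>n. X n \<in> S) \<Longrightarrow> X \<longlonglongrightarrow> x \<Longrightarrow> f x \<le> liminf (\<lambda>n. f (X n))"
  shows "lsc_on S f"
  unfolding lsc_on_def
proof
  fix \<alpha>
  let ?L = "{x \<in> S. f x \<le> \<alpha>}"
  have "x \<in> ?L" if x: "x \<in> S" "x \<in> closure ?L" for x
  proof -
    obtain X where X: "\<And>n. X n \<in> ?L" "X \<longlonglongrightarrow> x"
      using x(2) by (auto simp: closure_sequential)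
    then have "f x \<le> liminf (\<lambda>n. f (X n))"
      using x(1) by (intro assms) auto
    also have "\<dots> \<le> \<alpha>"
      using X(1) by (intro Liminf_le) auto
    finally show ?thesis
      using x(1) by simp
  qed
  then have "?L = S \<inter> closure ?L"
    using closure_subset[of ?L] by blast
  then show "closedin (top_of_set S) ?L"
    using closedin_closed by blast
qed

lemma liminf_mult_ge:
  fixes u v :: "nat \<Rightarrow> ennreal"
  assumes u: "a \<le> liminf u" and v: "v \<longlonglongrightarrow> b"
  shows "a * b \<le> liminf (\<lambda>n. u n * v n)"
proof -
  have "c * b \<le> liminf (\<lambda>n. u n * v n)" if "c < a" for c
  proof -
    have "c < top"
      using that by (rule less_le_trans) simp
    then have "(\<lambda>n. c * v n) \<longlonglongrightarrow> c * b"
      by (intro ennreal_tendsto_cmult v)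
    then have "c * b = liminf (\<lambda>n. c * v n)"
      by (simp add: lim_imp_Liminf)
    also have "\<forall>\<^sub>F n in sequentially. c < u n"
      using u that unfolding le_Liminf_iff by blast
    then have "liminf (\<lambda>n. c * v n) \<le> liminf (\<lambda>n. u n * v n)"
      by (intro Liminf_mono) (auto elim!: eventually_mono intro!: mult_right_mono)
    finally show ?thesis .
  qed
  then have "(SUP c\<in>{..<a}. c * b) \<le> liminf (\<lambda>n. u n * v n)"
    by (intro SUP_least) auto
  then show ?thesis
    using SUP_mult_right_ennreal[of "\<lambda>c. c" "{..<a}" b]
    by (cases "a = 0") (simp_all add: bot_ennreal)
qed

lemma lsc_on_mult_continuous:
  fixes f g :: "'a::first_countable_topology \<Rightarrow> ennreal"
  assumes "lsc_on S f" "continuous_on S g"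
  shows "lsc_on S (\<lambda>x. f x * g x)"
proof (rule lsc_onI_le_liminf)
  fix x X assume X: "x \<in> S" "\<And>n. X n \<in> S" "X \<longlonglongrightarrow> x"
  then have "(\<lambda>n. g (X n)) \<longlonglongrightarrow> g x"
    by (intro continuous_on_tendsto_compose[OF assms(2)]) auto
  then show "f x * g x \<le> liminf (\<lambda>n. f (X n) * g (X n))"
    by (intro liminf_mult_ge lsc_on_le_liminf[OF assms(1)] X)
qed

lemma lsc_on_nn_integral:
  fixes f :: "'a::first_countable_topology \<Rightarrow> 'z \<Rightarrow> ennreal"
  assumes "\<And>z. z \<in> space N \<Longrightarrow> lsc_on S (\<lambda>x. f x z)"
    and "\<And>x. x \<in> S \<Longrightarrow> f x \<in> borel_measurable N"
  shows "lsc_on S (\<lambda>x. \<integral>\<^sup>+z. f x z \<partial>N)"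
proof (rule lsc_onI_le_liminf)
  fix x X assume X: "x \<in> S" "\<And>n. X n \<in> S" "X \<longlonglongrightarrow> x"
  have "(\<integral>\<^sup>+z. f x z \<partial>N) \<le> (\<integral>\<^sup>+z. liminf (\<lambda>n. f (X n) z) \<partial>N)"
    by (intro nn_integral_mono lsc_on_le_liminf[OF assms(1)] X)
  also have "\<dots> \<le> liminf (\<lambda>n. \<integral>\<^sup>+z. f (X n) z \<partial>N)"
    by (intro nn_integral_liminf assms(2) X)
  finally show "(\<integral>\<^sup>+z. f x z \<partial>N) \<le> liminf (\<lambda>n. \<integral>\<^sup>+z. f (X n) z \<partial>N)" .
qed

lemma lsc_on_attains_min:
  assumes "compact K" "K \<noteq> {}" "lsc_on K f"
  obtains x where "x \<in> K" "\<And>y. y \<in> K \<Longrightarrow> f x \<le> f y"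
proof -
  have "\<exists>C. closed C \<and> {x \<in> K. f x \<le> f y} = K \<inter> C" for y
    using assms(3) by (auto simp: lsc_on_def closedin_closed)
  then obtain C where C: "\<And>y. closed (C y)" "\<And>y. {x \<in> K. f x \<le> f y} = K \<inter> C y"
    by metis
  have "K \<inter> (\<Inter>y\<in>K. C y) \<noteq> {}"
  proof (rule compact_imp_fip_image[OF assms(1) C(1)])
    fix I assume I: "finite I" "I \<subseteq> K"
    show "K \<inter> (\<Inter>y\<in>I. C y) \<noteq> {}"
    proof (cases "I = {}")
      case False
      with I obtain x where x: "x \<in> I" "\<And>y. y \<in> I \<Longrightarrow> f x \<le> f y"
        using ex_min_if_finite[of "f ` I"] by (auto simp: not_less)
      then have "x \<in> K \<inter> C y" if "y \<in> I" for y
        using C(2)[of y] I(2) that by auto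
      with x(1) I(2) show ?thesis
        by blast
    qed (use assms(2) in simp)
  qed
  then obtain x where "x \<in> K" "\<And>y. y \<in> K \<Longrightarrow> x \<in> C y"
    by blast
  with C(2) that show thesis
    by blast
qed

section \<open>Parametric minimisation over a closed graph\<close>

lemma closedin_Sigma_section:
  assumes "closedin (top_of_set (S \<times> K)) (Sigma S F)" "x \<in> S"
  shows "closedin (top_of_set K) (F x)"
proof -
  have "closedin (top_of_set K) (K \<inter> Pair x -` Sigma S F)"
    using assms by (intro continuous_closedin_preimage_gen) (auto intro: continuous_intros)
  moreover have "F x \<subseteq> K"
    using closedin_imp_subset[OF assms(1)] assms(2) by auto
  ultimately show ?thesis
    using assms(2) by (simp add: vimage_def Int_absorb1)
qed

lemma closedin_Sigma_Int:
  assumes "closedin (top_of_set (S \<times> K)) (Sigma S F)" "closed C"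
  shows "closedin (top_of_set (S \<times> K)) (Sigma S (\<lambda>x. F x \<inter> C))"
proof -
  have "closedin (top_of_set (S \<times> K)) (Sigma S F \<inter> (S \<times> K \<inter> UNIV \<times> C))"
    using assms by (intro closedin_Int closedin_closed_Int closed_Times closed_UNIV)
  also have "Sigma S F \<inter> (S \<times> K \<inter> UNIV \<times> C) = Sigma S (\<lambda>x. F x \<inter> C)"
    using closedin_imp_subset[OF assms(1)] by auto
  finally show ?thesis .
qed

lemma closedin_projection_compact:
  assumes "compact K" "closedin (top_of_set (S \<times> K)) G"
  shows "closedin (top_of_set S) (fst ` G)"
proof -
  have "closed_map (prod_topology (top_of_set S) (top_of_set K)) (top_of_set S) fst"
    using assms(1) by (intro closed_map_fst) (simp add: compact_space_subtopology)
  then show ?thesis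
    using assms(2) by (simp add: closed_map_def euclidean_product_topology flip: subtopology_Times)
qed

lemma lsc_on_attains_INF:
  fixes g :: "'a::topological_space \<Rightarrow> 'b::topological_space \<Rightarrow> 'c::complete_linorder"
  assumes g: "lsc_on (S \<times> K) (\<lambda>(x, p). g x p)" and K: "compact K"
    and F: "closedin (top_of_set (S \<times> K)) (Sigma S F)" and x: "x \<in> S" "F x \<noteq> {}"
  obtains p where "p \<in> F x" "g x p = (INF q\<in>F x. g x q)"
proof -
  have F_x: "closedin (top_of_set K) (F x)"
    using F x(1) by (rule closedin_Sigma_section)
  obtain p where p: "p \<in> F x" "\<And>q. q \<in> F x \<Longrightarrow> g x p \<le> g x q"
    using lsc_on_attains_min[OF closedin_compact[OF K F_x] x(2)
        lsc_on_section[OF g x(1) closedin_imp_subset[OF F_x]]] by blast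
  then have "g x p = (INF q\<in>F x. g x q)"
    by (intro antisym INF_greatest INF_lower)
  with p(1) show thesis
    by (rule that)
qed

lemma lsc_on_INF:
  fixes g :: "'a::topological_space \<Rightarrow> 'b::topological_space \<Rightarrow> 'c::complete_linorder"
  assumes g: "lsc_on (S \<times> K) (\<lambda>(x, p). g x p)" and K: "compact K"
    and F: "closedin (top_of_set (S \<times> K)) (Sigma S F)"
  shows "lsc_on S (\<lambda>x. INF p\<in>F x. g x p)"
  unfolding lsc_on_def
proof
  fix \<alpha>
  show "closedin (top_of_set S) {x \<in> S. (INF p\<in>F x. g x p) \<le> \<alpha>}"
  proof (cases "\<alpha> = top")
    case False
    have "\<exists>p\<in>F x. g x p \<le> \<alpha>" if x: "x \<in> S" "(INF p\<in>F x. g x p) \<le> \<alpha>" for x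
    proof -
      have "F x \<noteq> {}"
        using x(2) False by (auto simp: top_unique)
      then obtain p where "p \<in> F x" "g x p = (INF q\<in>F x. g x q)"
        by (rule lsc_on_attains_INF[OF g K F x(1)])
      with x(2) show ?thesis
        by (intro bexI[of _ p]) simp_all
    qed
    then have "{x \<in> S. (INF p\<in>F x. g x p) \<le> \<alpha>} =
        fst ` (Sigma S F \<inter> {q \<in> S \<times> K. (\<lambda>(x, p). g x p) q \<le> \<alpha>})"
      using closedin_imp_subset[OF F] by (force intro: INF_lower2)
    also have "closedin (top_of_set S) \<dots>"
      using g F by (intro closedin_projection_compact[OF K] closedin_Int) (auto simp: lsc_on_def)
    finally show ?thesis .
  qed simp
qed

lemma upper_hemicontinuous_on_imp_closedin_Sigma:
  fixes F :: "'a::t3_space \<Rightarrow> 'a set"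
  assumes uhc: "upper_hemicontinuous_on \<Theta> F"
    and F: "\<And>c. c \<in> \<Theta> \<Longrightarrow> closed (F c)" "\<And>c. c \<in> \<Theta> \<Longrightarrow> F c \<subseteq> \<Theta>"
  shows "closedin (top_of_set (\<Theta> \<times> \<Theta>)) (Sigma \<Theta> F)"
proof -
  have "\<exists>W. openin (top_of_set (\<Theta> \<times> \<Theta>)) W \<and> q \<in> W \<and> W \<subseteq> \<Theta> \<times> \<Theta> - Sigma \<Theta> F"
    if q: "q \<in> \<Theta> \<times> \<Theta> - Sigma \<Theta> F" for q
  proof -
    obtain c p where q_eq: "q = (c, p)" "c \<in> \<Theta>" "p \<notin> F c"
      using q by auto
    then obtain U V where UV: "open U" "open V" "p \<in> U" "F c \<subseteq> V" "U \<inter> V = {}"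
      using t3_space[OF F(1)[OF q_eq(2)] q_eq(3)] by blast
    then have "openin (top_of_set \<Theta>) (\<Theta> \<inter> V)" "F c \<subseteq> \<Theta> \<inter> V"
      using F(2)[OF q_eq(2)] by (auto intro: openin_open_Int)
    then obtain D where D: "open D" "c \<in> D" "\<And>c'. c' \<in> D \<Longrightarrow> F c' \<subseteq> \<Theta> \<inter> V"
      using uhc q_eq(2) unfolding upper_hemicontinuous_on_def by meson
    have "D \<times> U \<inter> Sigma \<Theta> F = {}"
      using D(3) UV(5) by blast
    then show ?thesis
      using q q_eq(1) D(1,2) UV(1,3)
      by (intro exI[of _ "\<Theta> \<times> \<Theta> \<inter> D \<times> U"] conjI openin_open_Int open_Times) auto
  qed
  then have "openin (top_of_set (\<Theta> \<times> \<Theta>)) (\<Theta> \<times> \<Theta> - Sigma \<Theta> F)"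
    using openin_subopen[of _ "\<Theta> \<times> \<Theta> - Sigma \<Theta> F"] by simp
  moreover have "Sigma \<Theta> F \<subseteq> \<Theta> \<times> \<Theta>"
    using F(2) by auto
  ultimately show ?thesis
    by (simp add: closedin_def)
qed

section \<open>Measurable selection\<close>

lemma measurable_restrict_space_borel_countable:
  fixes A :: "'a::t1_space set"
  assumes "countable A"
  shows "N \<rightarrow>\<^sub>M restrict_space borel A = N \<rightarrow>\<^sub>M count_space A"
proof (rule measurable_cong_sets[OF refl])
  have "X \<in> sets (restrict_space borel A)" if "X \<subseteq> A" for X
  proof -
    have "X \<in> sets borel"
      using countable_subset[OF that assms] by (rule sets.countable[rotated]) simp
    with that show ?thesis
      unfolding sets_restrict_space by (intro rev_image_eqI[of X]) auto
  qed
  moreover have "X \<subseteq> A" if "X \<in> sets (restrict_space borel A)" for X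
    using sets.sets_into_space[OF that] by (simp add: space_restrict_space)
  ultimately show "sets (restrict_space borel A) = sets (count_space A)"
    unfolding sets_count_space by blast
qed

lemma ex_measurable_argmax_finite:
  fixes f :: "'i \<Rightarrow> 'a \<Rightarrow> 'b::{linorder_topology,second_countable_topology}"
  assumes "finite A" "A \<noteq> {}" "\<And>a. a \<in> A \<Longrightarrow> f a \<in> borel_measurable N"
  shows "\<exists>s \<in> N \<rightarrow>\<^sub>M count_space A. \<forall>x\<in>space N. f (s x) x = Max ((\<lambda>a. f a x) ` A)"
  using assms
proof (induction rule: finite_ne_induct)
  case (singleton a)
  then show ?case
    by (intro bexI[of _ "\<lambda>_. a"]) auto
next
  case (insert a A)
  have "\<exists>s \<in> N \<rightarrow>\<^sub>M count_space A. \<forall>x\<in>space N. f (s x) x = Max ((\<lambda>a. f a x) ` A)"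
    by (rule insert.IH) (use insert.prems in simp)
  then obtain s where s: "s \<in> N \<rightarrow>\<^sub>M count_space A"
    and s_max: "\<And>x. x \<in> space N \<Longrightarrow> f (s x) x = Max ((\<lambda>a. f a x) ` A)"
    by blast
  have [measurable]: "(\<lambda>x. f (s x) x) \<in> borel_measurable N"
    by (rule measurable_compose_countable'[OF _ s])
      (use insert.prems insert.hyps(1) in \<open>simp_all add: countable_finite\<close>)
  have [measurable]: "f a \<in> borel_measurable N"
    using insert.prems by simp
  have [measurable]: "s \<in> N \<rightarrow>\<^sub>M count_space (insert a A)"
    using measurable_compose[OF s, of "\<lambda>a. a"] by simp
  let ?s = "\<lambda>x. if f (s x) x \<le> f a x then a else s x"
  have "?s \<in> N \<rightarrow>\<^sub>M count_space (insert a A)"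
    by measurable
  moreover have "f (?s x) x = Max ((\<lambda>a. f a x) ` insert a A)" if "x \<in> space N" for x
  proof -
    have "f (?s x) x = max (f a x) (f (s x) x)"
      by (cases "f (s x) x \<le> f a x") simp_all
    also have "\<dots> = Max ((\<lambda>a. f a x) ` insert a A)"
      using insert.hyps(1,2) by (simp add: s_max[OF that])
    finally show ?thesis .
  qed
  ultimately show ?case
    by (intro bexI[of _ ?s] ballI)
qed

lemma ex_closed_sequence_separating_points:
  "\<exists>C :: nat \<Rightarrow> 'b::{t2_space,second_countable_topology} set.
     (\<forall>n. closed (C n)) \<and> (\<forall>x y. x \<noteq> y \<longrightarrow> (\<exists>n. x \<in> C n \<and> y \<notin> C n))"
proof -
  obtain B :: "'b set set" where B: "countable B" "topological_basis B"
    using ex_countable_basis by blast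
  define C where "C n = closure (from_nat_into B n)" for n
  have "\<exists>n. x \<in> C n \<and> y \<notin> C n" if "x \<noteq> y" for x y :: 'b
  proof -
    obtain U V where UV: "open U" "open V" "x \<in> U" "y \<in> V" "U \<inter> V = {}"
      using hausdorff[OF \<open>x \<noteq> y\<close>] by blast
    obtain G where G: "G \<in> B" "x \<in> G" "G \<subseteq> U"
      using topological_basisE[OF B(2) UV(1,3)] by blast
    obtain n where n: "from_nat_into B n = G"
      using from_nat_into_surj[OF B(1) G(1)] by blast
    have "closure G \<subseteq> - V"
      using UV G by (intro closure_minimal) auto
    then show ?thesis
      using UV(4) G(2) closure_subset[of G] n by (auto simp: C_def)
  qed
  then show ?thesis
    by (intro exI[of _ C]) (auto simp: C_def)
qed

text \<open>A point of a compact set is singled out by cutting the set down successively with a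
  countable family of closed sets separating points, skipping the cuts that would empty it.\<close>

primrec refine :: "(nat \<Rightarrow> 'a set) \<Rightarrow> 'a set \<Rightarrow> nat \<Rightarrow> 'a set" where
  "refine C K 0 = K"
| "refine C K (Suc n) = (if refine C K n \<inter> C n = {} then refine C K n else refine C K n \<inter> C n)"

lemma compact_refine: "compact K \<Longrightarrow> (\<And>n. closed (C n)) \<Longrightarrow> compact (refine C K n)"
  by (induction n) (auto intro: compact_Int_closed)

lemma refine_nonempty: "K \<noteq> {} \<Longrightarrow> refine C K n \<noteq> {}"
  by (induction n) auto

lemma compact_decseq_Inter_nonempty:
  fixes K :: "nat \<Rightarrow> 'a::t2_space set"
  assumes "decseq K" "\<And>n. compact (K n)" "\<And>n. K n \<noteq> {}"
  shows "(\<Inter>n. K n) \<noteq> {}"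
proof -
  have "K 0 \<inter> (\<Inter>n\<in>UNIV. K n) \<noteq> {}"
  proof (rule compact_imp_fip_image[OF assms(2)])
    fix I :: "nat set" assume I: "finite I"
    have "K (Max (insert 0 I)) \<subseteq> K i" if "i \<in> insert 0 I" for i
      using I that by (intro decseqD[OF assms(1)] Max_ge) auto
    then show "K 0 \<inter> (\<Inter>i\<in>I. K i) \<noteq> {}"
      using assms(3)[of "Max (insert 0 I)"] by blast
  qed (intro compact_imp_closed assms(2))
  then show ?thesis
    by blast
qed

lemma Inter_refine_meets:
  fixes K :: "'a::t2_space set"
  assumes "compact K" "\<And>n. closed (C n)" "closed D" "\<And>n. refine C K n \<inter> D \<noteq> {}"
  shows "(\<Inter>n. refine C K n) \<inter> D \<noteq> {}"
proof -
  have "(\<Inter>n. refine C K n \<inter> D) \<noteq> {}"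
    using assms
    by (intro compact_decseq_Inter_nonempty compact_Int_closed compact_refine decseq_SucI) auto
  then show ?thesis
    by blast
qed

lemma Inter_refine_singleton:
  fixes K :: "'a::t2_space set"
  assumes "compact K" "K \<noteq> {}" "\<And>n. closed (C n)"
    and separating: "\<And>x y. x \<noteq> y \<Longrightarrow> \<exists>n. x \<in> C n \<and> y \<notin> C n"
  shows "\<exists>p. (\<Inter>n. refine C K n) = {p}"
proof -
  obtain p where p: "p \<in> (\<Inter>n. refine C K n)"
    using Inter_refine_meets[of K C UNIV] refine_nonempty[OF assms(2)] assms(1,3) by auto
  have "q = p" if q: "q \<in> (\<Inter>n. refine C K n)" for q
  proof (rule ccontr)
    assume "q \<noteq> p"
    then obtain n where n: "q \<in> C n" "p \<notin> C n"
      using separating by blast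
    with q have "refine C K n \<inter> C n \<noteq> {}"
      by blast
    then have "refine C K (Suc n) \<subseteq> C n"
      by simp
    with p n(2) show False
      by blast
  qed
  with p show ?thesis
    by blast
qed

lemma sets_refine_meets:
  assumes meets: "\<And>D. closed D \<Longrightarrow> {x \<in> space N. F x \<inter> D \<noteq> {}} \<in> sets N"
    and C: "\<And>n. closed (C n)" and "closed D"
  shows "{x \<in> space N. refine C (F x) n \<inter> D \<noteq> {}} \<in> sets N"
  using \<open>closed D\<close>
proof (induction n arbitrary: D)
  case (Suc n)
  let ?M = "\<lambda>D. {x \<in> space N. refine C (F x) n \<inter> D \<noteq> {}}"
  have "{x \<in> space N. refine C (F x) (Suc n) \<inter> D \<noteq> {}} = ?M (C n) \<inter> ?M (C n \<inter> D) \<union> (?M D - ?M (C n))"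
    by (auto simp: Int_assoc)
  also have "\<dots> \<in> sets N"
    using C Suc.prems by (intro sets.Un sets.Int sets.Diff Suc.IH closed_Int)
  finally show ?case .
qed (use meets in auto)

lemma ex_measurable_selection:
  fixes F :: "'a \<Rightarrow> 'b::{t2_space,second_countable_topology} set"
  assumes compact: "\<And>x. x \<in> space N \<Longrightarrow> compact (F x)"
    and nonempty: "\<And>x. x \<in> space N \<Longrightarrow> F x \<noteq> {}"
    and meets: "\<And>D. closed D \<Longrightarrow> {x \<in> space N. F x \<inter> D \<noteq> {}} \<in> sets N"
  shows "\<exists>s \<in> borel_measurable N. \<forall>x\<in>space N. s x \<in> F x"
proof -
  obtain C :: "nat \<Rightarrow> 'b set" where C: "\<And>n. closed (C n)" "\<And>x y. x \<noteq> y \<Longrightarrow> \<exists>n. x \<in> C n \<and> y \<notin> C n"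
    using ex_closed_sequence_separating_points by metis
  have "\<exists>p. (\<Inter>n. refine C (F x) n) = {p}" if "x \<in> space N" for x
    using compact[OF that] nonempty[OF that] C by (rule Inter_refine_singleton)
  then obtain s where s: "\<And>x. x \<in> space N \<Longrightarrow> (\<Inter>n. refine C (F x) n) = {s x}"
    by metis
  have s_refine: "s x \<in> refine C (F x) n" if "x \<in> space N" for x n
    using s[OF that] by (metis INT_E UNIV_I singletonI)
  have "s -` D \<inter> space N \<in> sets N" if D: "closed D" for D
  proof -
    have "s x \<in> D \<longleftrightarrow> (\<forall>n. refine C (F x) n \<inter> D \<noteq> {})" if x: "x \<in> space N" for x
    proof
      assume "\<forall>n. refine C (F x) n \<inter> D \<noteq> {}"
      then have "(\<Inter>n. refine C (F x) n) \<inter> D \<noteq> {}"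
        by (intro Inter_refine_meets compact x C(1) D) simp
      then show "s x \<in> D"
        by (simp add: s[OF x])
    qed (use s_refine[OF x] in blast)
    then have "s -` D \<inter> space N = (\<Inter>n. {x \<in> space N. refine C (F x) n \<inter> D \<noteq> {}})"
      by auto
    also have "\<dots> \<in> sets N"
      using sets_refine_meets[OF meets C(1) D] by (intro sets.countable_INT) auto
    finally show ?thesis .
  qed
  then have "s \<in> borel_measurable N"
    unfolding borel_eq_closed by (intro measurable_measure_of) auto
  moreover have "s x \<in> F x" if "x \<in> space N" for x
    using s_refine[OF that, of 0] by simp
  ultimately show ?thesis
    by blast
qed

definition argmin_on :: "'b set \<Rightarrow> ('b \<Rightarrow> 'c::complete_linorder) \<Rightarrow> 'b set" where
  "argmin_on K f = {p \<in> K. f p = (INF q\<in>K. f q)}"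

lemma compact_argmin_on:
  assumes "compact K" "lsc_on K f"
  shows "compact (argmin_on K f)"
proof -
  have "argmin_on K f = {p \<in> K. f p \<le> (INF q\<in>K. f q)}"
    by (auto simp: argmin_on_def intro: antisym INF_lower)
  also have "closedin (top_of_set K) \<dots>"
    using assms(2) by (simp add: lsc_on_def)
  finally show ?thesis
    by (rule closedin_compact[OF assms(1)])
qed

lemma argmin_on_meets_iff:
  fixes g :: "'a::topological_space \<Rightarrow> 'b::topological_space \<Rightarrow> 'c::complete_linorder"
  assumes g: "lsc_on (S \<times> K) (\<lambda>(x, p). g x p)" and K: "compact K"
    and F: "closedin (top_of_set (S \<times> K)) (Sigma S F)" and D: "closed D" and x: "x \<in> S"
  shows "argmin_on (F x) (g x) \<inter> D \<noteq> {} \<longleftrightarrow>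
    F x \<inter> D \<noteq> {} \<and> (INF p\<in>F x \<inter> D. g x p) \<le> (INF p\<in>F x. g x p)"
proof
  assume "argmin_on (F x) (g x) \<inter> D \<noteq> {}"
  then obtain p where p: "p \<in> F x \<inter> D" "g x p = (INF p\<in>F x. g x p)"
    by (auto simp: argmin_on_def)
  then have "(INF p\<in>F x \<inter> D. g x p) \<le> (INF p\<in>F x. g x p)"
    by (metis INF_lower)
  with p(1) show "F x \<inter> D \<noteq> {} \<and> (INF p\<in>F x \<inter> D. g x p) \<le> (INF p\<in>F x. g x p)"
    by blast
next
  assume meets: "F x \<inter> D \<noteq> {} \<and> (INF p\<in>F x \<inter> D. g x p) \<le> (INF p\<in>F x. g x p)"
  then have "F x \<inter> D \<noteq> {}"
    by simp
  then obtain p where p: "p \<in> F x \<inter> D" "g x p = (INF p\<in>F x \<inter> D. g x p)"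
    by (rule lsc_on_attains_INF[OF g K closedin_Sigma_Int[OF F D] x])
  then have "g x p = (INF p\<in>F x. g x p)"
    using meets by (intro antisym INF_lower) simp_all
  with p(1) show "argmin_on (F x) (g x) \<inter> D \<noteq> {}"
    by (auto simp: argmin_on_def)
qed

lemma ex_measurable_argmin:
  fixes g :: "'a::topological_space \<Rightarrow> 'b::{t2_space,second_countable_topology}
    \<Rightarrow> 'c::{complete_linorder,linorder_topology,second_countable_topology}"
  assumes g: "lsc_on (S \<times> K) (\<lambda>(x, p). g x p)" and K: "compact K"
    and F: "closedin (top_of_set (S \<times> K)) (Sigma S F)" "\<And>x. x \<in> S \<Longrightarrow> F x \<noteq> {}"
  shows "\<exists>s \<in> borel_measurable (restrict_space borel S). \<forall>x\<in>S. s x \<in> argmin_on (F x) (g x)"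
proof -
  let ?N = "restrict_space borel S :: 'a measure"
  note meets_iff = argmin_on_meets_iff[OF g K F(1)]
  have space_N: "space ?N = S"
    by (simp add: space_restrict_space)
  have "\<exists>s \<in> borel_measurable ?N. \<forall>x\<in>space ?N. s x \<in> argmin_on (F x) (g x)"
  proof (rule ex_measurable_selection, unfold space_N)
    fix x assume x: "x \<in> S"
    show "argmin_on (F x) (g x) \<noteq> {}"
      using meets_iff[OF closed_UNIV x] F(2)[OF x] by simp
    have F_x: "closedin (top_of_set K) (F x)"
      using F(1) x by (rule closedin_Sigma_section)
    show "compact (argmin_on (F x) (g x))"
      by (intro compact_argmin_on closedin_compact[OF K F_x] lsc_on_section[OF g x]
          closedin_imp_subset[OF F_x])
  next
    fix D :: "'b set" assume D: "closed D"
    have INF_measurable: "(\<lambda>x. INF p\<in>F x \<inter> C. g x p) \<in> borel_measurable ?N" if "closed C" for C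
      using that by (intro lsc_on_measurable lsc_on_INF[OF g K] closedin_Sigma_Int F(1))
    have "{x \<in> space ?N. (INF p\<in>F x \<inter> D. g x p) \<le> (INF p\<in>F x \<inter> UNIV. g x p)} \<in> sets ?N"
      by (rule borel_measurable_le[OF INF_measurable[OF D] INF_measurable[OF closed_UNIV]])
    moreover have "fst ` Sigma S (\<lambda>x. F x \<inter> D) \<in> sets ?N"
      using D K F(1)
      by (intro closedin_imp_sets_restrict_space closedin_projection_compact closedin_Sigma_Int)
    moreover have "{x \<in> S. argmin_on (F x) (g x) \<inter> D \<noteq> {}} = fst ` Sigma S (\<lambda>x. F x \<inter> D) \<inter>
        {x \<in> space ?N. (INF p\<in>F x \<inter> D. g x p) \<le> (INF p\<in>F x \<inter> UNIV. g x p)}"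
      using meets_iff[OF D] by (auto simp: space_N fst_image_Sigma)
    ultimately show "{x \<in> S. argmin_on (F x) (g x) \<inter> D \<noteq> {}} \<in> sets ?N"
      by simp
  qed
  then show ?thesis
    by (simp only: space_N)
qed

context adaptive_robust
begin

section \<open>Controls and rewards\<close>

abbreviation gain :: "nat \<Rightarrow> ('n, 'd) state \<Rightarrow> real^'k \<Rightarrow> real" where
  "gain t y a \<equiv> exp (risk M * discount M ^ t * reward M t (fst y) a)"

text \<open>The terminal reward ignores its control argument, so every control is feasible there.\<close>

abbreviation feasible :: "nat \<Rightarrow> real^'k \<Rightarrow> bool" where
  "feasible t a \<equiv> t < horizon M \<longrightarrow> a \<in> controls M"

abbreviation control_map :: "(('n, 'd) state \<Rightarrow> real^'k) \<Rightarrow> bool" where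
  "control_map f \<equiv> f \<in> state_space M \<rightarrow>\<^sub>M restrict_space borel (controls M)"

abbreviation param_map :: "(('n, 'd) state \<Rightarrow> real^'d) \<Rightarrow> bool" where
  "param_map g \<equiv> g \<in> state_space M \<rightarrow>\<^sub>M restrict_space borel (params M)"

lemma control_map_in: "control_map f \<Longrightarrow> y \<in> states M \<Longrightarrow> f y \<in> controls M"
  by (auto simp: measurable_restrict_space2_iff space_state_space)

lemma param_map_in: "param_map g \<Longrightarrow> y \<in> states M \<Longrightarrow> g y \<in> params M"
  by (auto simp: measurable_restrict_space2_iff space_state_space)

lemma control_map_iff_count_space: "control_map f \<longleftrightarrow> f \<in> state_space M \<rightarrow>\<^sub>M count_space (controls M)"
  using controls_finite by (simp add: measurable_restrict_space_borel_countable countable_finite)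

lemma measurable_compose_control_map:
  assumes "control_map f" "\<And>a. a \<in> controls M \<Longrightarrow> h a \<in> state_space M \<rightarrow>\<^sub>M N"
  shows "(\<lambda>y. h (f y) y) \<in> state_space M \<rightarrow>\<^sub>M N"
  using assms(2) assms(1)[unfolded control_map_iff_count_space] countable_finite[OF controls_finite]
  by (rule measurable_compose_countable')

lemma lsc_on_states_measurable:
  fixes h :: "('n, 'd) state \<Rightarrow> 'b::{linorder_topology,second_countable_topology}"
  shows "lsc_on (states M) h \<Longrightarrow> h \<in> borel_measurable (state_space M)"
  unfolding state_space_def by (rule lsc_on_measurable)

lemma continuous_on_reward:
  assumes "t \<le> horizon M" "feasible t a"
  shows "continuous_on S (\<lambda>y :: ('n, 'd) state. reward M t (fst y) a)"
proof -
  have "continuous_on UNIV (\<lambda>x. reward M t x a)"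
    using assms run_reward_continuous end_reward_continuous
    by (cases "t = horizon M") (auto simp: reward_def)
  then show ?thesis
    by (rule continuous_on_compose2) (auto intro: continuous_intros)
qed

lemma reward_measurable:
  assumes "t \<le> horizon M" "t < horizon M \<Longrightarrow> control_map f"
  shows "(\<lambda>y. reward M t (fst y) (f y)) \<in> borel_measurable (state_space M)"
proof (cases "t < horizon M")
  case True
  show ?thesis
  proof (rule measurable_compose_control_map[OF assms(2)[OF True]])
    fix a assume "a \<in> controls M"
    then show "(\<lambda>y :: ('n, 'd) state. reward M t (fst y) a) \<in> borel_measurable (state_space M)"
      using assms(1)
      by (intro lsc_on_states_measurable continuous_on_imp_lsc_on continuous_on_reward) simp_all
  qed
next
  case False
  then have "(\<lambda>y :: ('n, 'd) state. reward M t (fst y) undefined) \<in> borel_measurable (state_space M)"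
    using assms(1)
    by (intro lsc_on_states_measurable continuous_on_imp_lsc_on continuous_on_reward) auto
  with False assms(1) show ?thesis
    by (simp add: reward_def)
qed

lemma reward_bounded_above:
  assumes "t \<le> horizon M"
  shows "\<exists>B. \<forall>x a. feasible t a \<longrightarrow> reward M t x a \<le> B"
proof (cases "t < horizon M")
  case True
  have "bounded (\<Union>a\<in>controls M. range (\<lambda>x. run_reward M t x a))"
    using run_reward_bounded[OF True] controls_finite by (intro bounded_UN) auto
  then obtain B where "\<And>x a. a \<in> controls M \<Longrightarrow> \<bar>run_reward M t x a\<bar> \<le> B"
    unfolding bounded_iff by (metis UN_I rangeI real_norm_def)
  with True show ?thesis
    by (auto simp: reward_def intro: abs_le_D1)
next
  case False
  obtain B where "\<And>x. \<bar>end_reward M x\<bar> \<le> B"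
    using end_reward_bounded by (auto simp: bounded_iff)
  with False assms show ?thesis
    by (auto simp: reward_def intro: abs_le_D1)
qed

lemma gain_bounded_above:
  assumes "t \<le> horizon M"
  shows "\<exists>c. \<forall>y a. feasible t a \<longrightarrow> gain t y a \<le> c"
proof -
  obtain B where B: "\<And>x a. feasible t a \<Longrightarrow> reward M t x a \<le> B"
    using reward_bounded_above[OF assms] by blast
  have "gain t y a \<le> exp (risk M * discount M ^ t * B)" if "feasible t a" for y a
    using B[OF that] risk_pos discount_pos by (auto intro!: mult_left_mono)
  then show ?thesis
    by blast
qed

section \<open>The transition kernel\<close>

lemma
  assumes "t < horizon M" "y \<in> states M" "a \<in> controls M" "\<theta> \<in> params M"
  shows prob_space_Q_kernel: "prob_space (Q_kernel M t y a \<theta>)"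
    and sets_Q_kernel: "sets (Q_kernel M t y a \<theta>) = sets (state_space M)"
    and space_Q_kernel: "space (Q_kernel M t y a \<theta>) = states M"
proof -
  have "(y, \<theta>) \<in> space (state_space M \<Otimes>\<^sub>M restrict_space borel (params M))"
    using assms by (simp add: space_pair_measure space_state_space space_restrict_space)
  from measurable_space[OF Q_kernel_measurable[OF assms(1,3)] this]
  show "prob_space (Q_kernel M t y a \<theta>)" and sets: "sets (Q_kernel M t y a \<theta>) = sets (state_space M)"
    by (auto simp: space_prob_algebra)
  from sets_eq_imp_space_eq[OF sets] show "space (Q_kernel M t y a \<theta>) = states M"
    by (simp add: space_state_space)
qed

lemma Q_kernel_eq_distr_density:
  assumes "t < horizon M" "y \<in> states M" "a \<in> controls M" "\<theta> \<in> params M"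
  shows "Q_kernel M t y a \<theta> =
    distr (density lborel (\<lambda>z. ennreal (noise_density M z \<theta>))) (state_space M) (transition M t y a)"
proof -
  have noise: "distributed (prob_law M \<theta>) lborel (noise M (Suc t)) (\<lambda>z. ennreal (noise_density M z \<theta>))"
    using assms(4) by (intro noise_distributed) simp_all
  have "Q_kernel M t y a \<theta> =
      distr (distr (prob_law M \<theta>) lborel (noise M (Suc t))) (state_space M) (transition M t y a)"
    unfolding Q_kernel_def using transition_measurable[OF assms(1-3)] distributed_measurable[OF noise]
    by (subst distr_distr) (simp_all add: comp_def)
  then show ?thesis
    by (simp add: distributed_distr_eq_density[OF noise])
qed

lemma nn_integral_Q_kernel:
  assumes "t < horizon M" "y \<in> states M" "a \<in> controls M" "\<theta> \<in> params M"
    and h [measurable]: "h \<in> borel_measurable (state_space M)"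
  shows "(\<integral>\<^sup>+y'. h y' \<partial>Q_kernel M t y a \<theta>) =
    (\<integral>\<^sup>+z. h (transition M t y a z) * ennreal (noise_density M z \<theta>) \<partial>lborel)"
proof -
  have [measurable]: "transition M t y a \<in> borel \<rightarrow>\<^sub>M state_space M"
    by (rule transition_measurable[OF assms(1-3)])
  have [measurable]: "(\<lambda>z. ennreal (noise_density M z \<theta>)) \<in> borel_measurable lborel"
    using noise_distributed[of 1 \<theta>] assms(4) by (simp add: distributed_def)
  have "(\<integral>\<^sup>+y'. h y' \<partial>Q_kernel M t y a \<theta>) =
      (\<integral>\<^sup>+z. h (transition M t y a z) \<partial>density lborel (\<lambda>z. ennreal (noise_density M z \<theta>)))"
    unfolding Q_kernel_eq_distr_density[OF assms(1-4)] by (intro nn_integral_distr) simp_all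
  also have "\<dots> = (\<integral>\<^sup>+z. ennreal (noise_density M z \<theta>) * h (transition M t y a z) \<partial>lborel)"
    by (intro nn_integral_density) simp_all
  finally show ?thesis
    by (simp add: mult.commute)
qed

lemma continuous_on_transition:
  assumes "t < horizon M" "a \<in> controls M"
  shows "continuous_on (states M) (\<lambda>y. transition M t y a z)"
proof -
  have "continuous_on UNIV (\<lambda>y :: ('n, 'd) state. dyn M (fst y) a z)"
    by (rule continuous_on_compose2[OF dyn_continuous[OF assms(2)]]) (auto intro: continuous_intros)
  moreover have "continuous_on UNIV (\<lambda>y :: ('n, 'd) state. (\<lambda>(c, z). estim M t c z) (snd y, z))"
    by (rule continuous_on_compose2[OF estim_continuous[OF assms(1)]]) (auto intro!: continuous_intros)
  ultimately show ?thesis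
    unfolding transition_def by (auto intro!: continuous_on_Pair intro: continuous_on_subset)
qed

lemma transition_in_states:
  assumes "t < horizon M" "y \<in> states M" "a \<in> controls M"
  shows "transition M t y a z \<in> states M"
  using measurable_space[OF transition_measurable[OF assms], of z] by (simp add: space_state_space)

lemma closedin_graph_region:
  assumes t: "t < horizon M"
  shows "closedin (top_of_set (states M \<times> params M)) (Sigma (states M) (\<lambda>y. region M t (snd y)))"
proof -
  let ?f = "\<lambda>(y, \<theta>). (snd y, \<theta>) :: (real^'d) \<times> (real^'d)"
  have "closedin (top_of_set (params M \<times> params M)) (Sigma (params M) (region M t))"
    using t by (intro upper_hemicontinuous_on_imp_closedin_Sigma region_uhc region_subset
        compact_imp_closed[OF region_compact])
  then have "closedin (top_of_set (states M \<times> params M))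
      (states M \<times> params M \<inter> ?f -` Sigma (params M) (region M t))"
    by (intro continuous_closedin_preimage_gen)
      (auto simp: states_def split_beta intro!: continuous_intros)
  also have "states M \<times> params M \<inter> ?f -` Sigma (params M) (region M t) =
      Sigma (states M) (\<lambda>y. region M t (snd y))"
    using region_subset[OF t] by (auto simp: states_def)
  finally show ?thesis .
qed

section \<open>The one-step operators\<close>

definition one_step ::
  "nat \<Rightarrow> (('n, 'd) state \<Rightarrow> ennreal) \<Rightarrow> ('n, 'd) state \<Rightarrow> real^'k \<Rightarrow> real^'d \<Rightarrow> ennreal" where
  "one_step t h y a \<theta> = ennreal (gain t y a) * (\<integral>\<^sup>+y'. h y' \<partial>Q_kernel M t y a \<theta>)"

definition robust_step ::
  "nat \<Rightarrow> (('n, 'd) state \<Rightarrow> ennreal) \<Rightarrow> ('n, 'd) state \<Rightarrow> real^'k \<Rightarrow> ennreal" where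
  "robust_step t h y a = (INF \<theta>\<in>region M t (snd y). one_step t h y a \<theta>)"

lemma one_step_mono:
  assumes "t < horizon M" "y \<in> states M" "a \<in> controls M" "\<theta> \<in> params M"
    and "\<And>y'. y' \<in> states M \<Longrightarrow> h y' \<le> h' y'"
  shows "one_step t h y a \<theta> \<le> one_step t h' y a \<theta>"
  unfolding one_step_def using assms(5)
  by (intro mult_left_mono nn_integral_mono) (simp_all add: space_Q_kernel[OF assms(1-4)])

lemma one_step_const:
  assumes "t < horizon M" "y \<in> states M" "a \<in> controls M" "\<theta> \<in> params M"
  shows "one_step t (\<lambda>_. c) y a \<theta> = ennreal (gain t y a) * c"
  using prob_space.emeasure_space_1[OF prob_space_Q_kernel[OF assms]] by (simp add: one_step_def)

lemma lsc_on_one_step: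
  assumes t: "t < horizon M" and a: "a \<in> controls M" and h: "lsc_on (states M) h"
  shows "lsc_on (states M \<times> params M) (\<lambda>(y, \<theta>). one_step t h y a \<theta>)"
proof -
  note [measurable] = lsc_on_states_measurable[OF h]
  let ?S = "states M \<times> params M"
  let ?f = "\<lambda>q z. h (transition M t (fst q) a z) * ennreal (noise_density M z (snd q))"
  have "lsc_on ?S (\<lambda>q. (\<integral>\<^sup>+z. ?f q z \<partial>lborel) * ennreal (gain t (fst q) a))"
  proof (intro lsc_on_mult_continuous lsc_on_nn_integral lsc_on_compose[OF h] continuous_on_ennreal)
    show "continuous_on ?S (\<lambda>q. transition M t (fst q) a z)" for z
      by (rule continuous_on_compose2[OF continuous_on_transition[OF t a]])
        (auto intro: continuous_intros)
    show "(\<lambda>q. transition M t (fst q) a z) \<in> ?S \<rightarrow> states M" for z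
      using transition_in_states[OF t _ a] by auto
    show "continuous_on ?S (\<lambda>q. noise_density M z (snd q))" for z
      by (rule continuous_on_compose2[OF noise_density_continuous]) (auto intro: continuous_intros)
    have "continuous_on (states M) (\<lambda>y. gain t y a)"
      using t a by (intro continuous_intros continuous_on_reward) auto
    then show "continuous_on ?S (\<lambda>q. gain t (fst q) a)"
      by (rule continuous_on_compose2) (auto intro: continuous_intros)
  next
    fix q assume q: "q \<in> ?S"
    have [measurable]: "transition M t (fst q) a \<in> borel \<rightarrow>\<^sub>M state_space M"
      using transition_measurable[OF t _ a, of "fst q"] q by auto
    have [measurable]: "(\<lambda>z. ennreal (noise_density M z (snd q))) \<in> borel_measurable borel"
      using noise_distributed[of 1 "snd q"] q by (auto simp: distributed_def)
    show "?f q \<in> borel_measurable lborel"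
      by simp
  qed
  also have "?this \<longleftrightarrow> ?thesis"
    by (intro lsc_on_cong) (auto simp: one_step_def nn_integral_Q_kernel[OF t _ a] mult.commute)
  finally show ?thesis .
qed

lemma lsc_on_robust_step:
  assumes "t < horizon M" "a \<in> controls M" "lsc_on (states M) h"
  shows "lsc_on (states M) (\<lambda>y. robust_step t h y a)"
  unfolding robust_step_def
  by (intro lsc_on_INF[OF lsc_on_one_step[OF assms]] params_compact closedin_graph_region assms(1))

lemma ex_worst_parameter:
  assumes t: "t < horizon M" and f: "control_map f" and h: "lsc_on (states M) h"
  shows "\<exists>g. param_map g \<and> (\<forall>y\<in>states M. g y \<in> region M t (snd y) \<and>
    one_step t h y (f y) (g y) = robust_step t h y (f y))"
proof -
  have "\<forall>a\<in>controls M. \<exists>g \<in> borel_measurable (state_space M). \<forall>y\<in>states M.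
      g y \<in> argmin_on (region M t (snd y)) (one_step t h y a)"
    unfolding state_space_def
    using t h region_nonempty[OF t]
    by (intro ballI ex_measurable_argmin[OF lsc_on_one_step] params_compact closedin_graph_region) auto
  then obtain g where g: "\<And>a. a \<in> controls M \<Longrightarrow> g a \<in> borel_measurable (state_space M)"
    "\<And>a y. a \<in> controls M \<Longrightarrow> y \<in> states M \<Longrightarrow> g a y \<in> region M t (snd y)"
    "\<And>a y. a \<in> controls M \<Longrightarrow> y \<in> states M \<Longrightarrow> one_step t h y a (g a y) = robust_step t h y a"
    unfolding argmin_on_def robust_step_def by (metis (mono_tags, lifting) mem_Collect_eq)
  let ?g = "\<lambda>y. g (f y) y"
  have "?g \<in> borel_measurable (state_space M)"
    using f g(1) by (rule measurable_compose_control_map)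
  moreover have "?g y \<in> params M" if "y \<in> states M" for y
    using g(2)[OF control_map_in[OF f that] that] region_subset[OF t] by blast
  ultimately have "param_map ?g"
    by (intro measurable_restrict_space2) (auto simp: space_state_space)
  then show ?thesis
    using g(2,3) control_map_in[OF f] by (intro exI[of _ ?g]) auto
qed

section \<open>Regularity of the Bellman functions\<close>

definition nonneg_bounded_lsc :: "(('n, 'd) state \<Rightarrow> real) \<Rightarrow> bool" where
  "nonneg_bounded_lsc V \<longleftrightarrow>
     (\<forall>y\<in>states M. 0 \<le> V y) \<and> bounded (V ` states M) \<and> lsc_on (states M) V"

lemma nonneg_bounded_lsc_nonneg: "nonneg_bounded_lsc V \<Longrightarrow> y \<in> states M \<Longrightarrow> 0 \<le> V y"
  by (simp add: nonneg_bounded_lsc_def)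

lemma nonneg_bounded_lsc_upper_bound:
  assumes "nonneg_bounded_lsc V"
  obtains B where "0 \<le> B" "\<And>y. y \<in> states M \<Longrightarrow> V y \<le> B"
proof -
  obtain B where "0 < B" "\<forall>v\<in>V ` states M. norm v \<le> B"
    using assms by (auto simp: nonneg_bounded_lsc_def bounded_pos)
  then have "0 \<le> B" "V y \<le> B" if "y \<in> states M" for y
    using that by fastforce+
  with \<open>0 < B\<close> show thesis
    by (intro that[of B]) simp_all
qed

lemma nonneg_bounded_lscI:
  assumes "\<And>y. y \<in> states M \<Longrightarrow> 0 \<le> V y" "\<And>y. y \<in> states M \<Longrightarrow> V y \<le> B" "lsc_on (states M) V"
  shows "nonneg_bounded_lsc V"
  using assms by (auto simp: nonneg_bounded_lsc_def bounded_iff intro!: exI[of _ B])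

lemma nonneg_bounded_lsc_imp_lsc_on_ennreal:
  "nonneg_bounded_lsc V \<Longrightarrow> lsc_on (states M) (\<lambda>y. ennreal (V y))"
  by (simp add: nonneg_bounded_lsc_def lsc_on_ennreal_iff)

lemma nonneg_bounded_lsc_Max:
  assumes "finite I" "I \<noteq> {}" "\<And>i. i \<in> I \<Longrightarrow> nonneg_bounded_lsc (V i)"
  shows "nonneg_bounded_lsc (\<lambda>y. Max ((\<lambda>i. V i y) ` I))"
proof -
  have "Max ((\<lambda>i. V i y) ` I) \<in> (\<lambda>i. V i y) ` I" for y
    using assms(1,2) by (intro Max_in) auto
  then have attained: "\<exists>i\<in>I. Max ((\<lambda>i. V i y) ` I) = V i y" for y
    by blast
  then have "(\<lambda>y. Max ((\<lambda>i. V i y) ` I)) ` states M \<subseteq> (\<Union>i\<in>I. V i ` states M)"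
    by fast
  moreover have "bounded (\<Union>i\<in>I. V i ` states M)"
    using assms(1,3) by (intro bounded_UN) (auto simp: nonneg_bounded_lsc_def)
  ultimately have "bounded ((\<lambda>y. Max ((\<lambda>i. V i y) ` I)) ` states M)"
    by (rule bounded_subset[rotated])
  moreover have "0 \<le> Max ((\<lambda>i. V i y) ` I)" if "y \<in> states M" for y
    using attained[of y] nonneg_bounded_lsc_nonneg[OF assms(3) that] by auto
  moreover have "lsc_on (states M) (\<lambda>y. Max ((\<lambda>i. V i y) ` I))"
    using assms by (intro lsc_on_Max) (auto simp: nonneg_bounded_lsc_def)
  ultimately show ?thesis
    by (simp add: nonneg_bounded_lsc_def)
qed

lemma ennreal_integral_Q_kernel:
  assumes "t < horizon M" "y \<in> states M" "a \<in> controls M" "\<theta> \<in> params M" and V: "nonneg_bounded_lsc V"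
  shows "ennreal (\<integral>y'. V y' * gain t y a \<partial>Q_kernel M t y a \<theta>) = one_step t (\<lambda>y'. ennreal (V y')) y a \<theta>"
proof -
  interpret Q: prob_space "Q_kernel M t y a \<theta>"
    by (rule prob_space_Q_kernel[OF assms(1-4)])
  note space = space_Q_kernel[OF assms(1-4)]
  obtain B where B: "\<And>y. y \<in> states M \<Longrightarrow> V y \<le> B"
    using nonneg_bounded_lsc_upper_bound[OF V] by blast
  have "V \<in> borel_measurable (state_space M)"
    using V by (intro lsc_on_states_measurable) (simp add: nonneg_bounded_lsc_def)
  then have [measurable]: "V \<in> borel_measurable (Q_kernel M t y a \<theta>)"
    by (simp cong: measurable_cong_sets add: sets_Q_kernel[OF assms(1-4)])
  have integrable: "integrable (Q_kernel M t y a \<theta>) V"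
    using nonneg_bounded_lsc_nonneg[OF V] B
    by (intro Q.integrable_const_bound[of _ B] AE_I2) (simp_all add: space)
  have "ennreal (\<integral>y'. V y' * gain t y a \<partial>Q_kernel M t y a \<theta>) =
      ennreal (gain t y a) * ennreal (\<integral>y'. V y' \<partial>Q_kernel M t y a \<theta>)"
    by (simp add: ennreal_mult'' mult.commute[of "ennreal (gain t y a)"])
  also have "ennreal (\<integral>y'. V y' \<partial>Q_kernel M t y a \<theta>) = (\<integral>\<^sup>+y'. ennreal (V y') \<partial>Q_kernel M t y a \<theta>)"
    using integrable nonneg_bounded_lsc_nonneg[OF V]
    by (intro nn_integral_eq_integral[symmetric] AE_I2) (simp_all add: space)
  finally show ?thesis
    by (simp add: one_step_def)
qed

lemma
  assumes t: "t < horizon M" and y: "y \<in> states M" and a: "a \<in> controls M" and V: "nonneg_bounded_lsc V"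
  shows bellman_inf_nonneg: "0 \<le> bellman_inf M t V y a"
    and ennreal_bellman_inf: "ennreal (bellman_inf M t V y a) = robust_step t (\<lambda>y'. ennreal (V y')) y a"
proof -
  have params: "\<theta> \<in> params M" if "\<theta> \<in> region M t (snd y)" for \<theta>
    using that region_subset[OF t] by blast
  have nonneg: "0 \<le> (\<integral>y'. V y' * gain t y a \<partial>Q_kernel M t y a \<theta>)" if "\<theta> \<in> region M t (snd y)" for \<theta>
    using nonneg_bounded_lsc_nonneg[OF V] space_Q_kernel[OF t y a params[OF that]]
    by (intro Bochner_Integration.integral_nonneg) simp
  then show "0 \<le> bellman_inf M t V y a"
    unfolding bellman_inf_def by (intro cINF_greatest region_nonempty t)
  have "ennreal (bellman_inf M t V y a) =
      (INF \<theta>\<in>region M t (snd y). ennreal (\<integral>y'. V y' * gain t y a \<partial>Q_kernel M t y a \<theta>))"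
    unfolding bellman_inf_def using nonneg
    by (intro ennreal_cINF region_nonempty t bdd_belowI[of _ 0]) auto
  also have "\<dots> = robust_step t (\<lambda>y'. ennreal (V y')) y a"
    unfolding robust_step_def by (intro INF_cong refl ennreal_integral_Q_kernel t y a params V)
  finally show "ennreal (bellman_inf M t V y a) = robust_step t (\<lambda>y'. ennreal (V y')) y a" .
qed

lemma bellman_inf_upper_bound:
  assumes t: "t < horizon M" and y: "y \<in> states M" and a: "a \<in> controls M" and V: "nonneg_bounded_lsc V"
    and B: "0 \<le> B" "\<And>y. y \<in> states M \<Longrightarrow> V y \<le> B"
  shows "bellman_inf M t V y a \<le> gain t y a * B"
proof -
  obtain \<theta> where \<theta>: "\<theta> \<in> region M t (snd y)" "\<theta> \<in> params M"
    using region_nonempty[OF t] region_subset[OF t] by blast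
  have "ennreal (bellman_inf M t V y a) \<le> one_step t (\<lambda>y'. ennreal (V y')) y a \<theta>"
    unfolding ennreal_bellman_inf[OF t y a V] robust_step_def using \<theta>(1) by (rule INF_lower)
  also have "\<dots> \<le> one_step t (\<lambda>_. ennreal B) y a \<theta>"
    by (intro one_step_mono t y a \<theta>(2) ennreal_leI B(2))
  also have "\<dots> = ennreal (gain t y a * B)"
    by (simp add: one_step_const[OF t y a \<theta>(2)] ennreal_mult' flip: ennreal_mult'')
  finally show ?thesis
    using B(1) by simp
qed

lemma nonneg_bounded_lsc_bellman_inf:
  assumes t: "t < horizon M" and a: "a \<in> controls M" and V: "nonneg_bounded_lsc V"
  shows "nonneg_bounded_lsc (\<lambda>y. bellman_inf M t V y a)"
proof -
  obtain B where B: "0 \<le> B" "\<And>y. y \<in> states M \<Longrightarrow> V y \<le> B"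
    using nonneg_bounded_lsc_upper_bound[OF V] by blast
  obtain c where gain_le: "\<And>y a. feasible t a \<Longrightarrow> gain t y a \<le> c"
    using gain_bounded_above[OF less_imp_le[OF t]] by blast
  have nonneg: "0 \<le> bellman_inf M t V y a" if "y \<in> states M" for y
    using t that a V by (rule bellman_inf_nonneg)
  have upper: "bellman_inf M t V y a \<le> c * B" if "y \<in> states M" for y
  proof -
    have "bellman_inf M t V y a \<le> gain t y a * B"
      by (intro bellman_inf_upper_bound t that a V B)
    also have "\<dots> \<le> c * B"
      using a B(1) by (intro mult_right_mono gain_le) simp_all
    finally show ?thesis .
  qed
  have "lsc_on (states M) (\<lambda>y. robust_step t (\<lambda>y'. ennreal (V y')) y a)"
    by (intro lsc_on_robust_step t a nonneg_bounded_lsc_imp_lsc_on_ennreal V)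
  also have "?this \<longleftrightarrow> lsc_on (states M) (\<lambda>y. ennreal (bellman_inf M t V y a))"
    by (intro lsc_on_cong) (simp add: ennreal_bellman_inf[OF t _ a V])
  also have "\<dots> \<longleftrightarrow> lsc_on (states M) (\<lambda>y. bellman_inf M t V y a)"
    using nonneg by (rule lsc_on_ennreal_iff)
  finally show ?thesis
    using nonneg upper by (intro nonneg_bounded_lscI[of _ "c * B"])
qed

lemma W_value_horizon: "W_value M (horizon M) y = gain (horizon M) y a"
  by (simp add: W_value.simps[of M "horizon M"] reward_def)

lemma W_value_step:
  "t < horizon M \<Longrightarrow> W_value M t y = Max (bellman_inf M t (W_value M (Suc t)) y ` controls M)"
  by (simp add: W_value.simps[of M t])

lemma nonneg_bounded_lsc_W_value: "t \<le> horizon M \<Longrightarrow> nonneg_bounded_lsc (W_value M t)"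
proof (induction t rule: inc_induct)
  case base
  obtain c where "\<And>y a. feasible (horizon M) a \<Longrightarrow> gain (horizon M) y a \<le> c"
    using gain_bounded_above[OF order_refl] by blast
  then have "gain (horizon M) y a \<le> c" for y a
    by simp
  moreover have "lsc_on (states M) (\<lambda>y. gain (horizon M) y undefined)"
    by (intro continuous_on_imp_lsc_on continuous_intros continuous_on_reward) auto
  ultimately show ?case
    unfolding W_value_horizon[where a = undefined, abs_def] by (intro nonneg_bounded_lscI[of _ c]) auto
next
  case (step t)
  show ?case
    unfolding W_value_step[OF step.hyps(2), abs_def]
    by (rule nonneg_bounded_lsc_Max[OF controls_finite controls_nonempty
          nonneg_bounded_lsc_bellman_inf[OF step.hyps(2) _ step.IH]])
qed

lemma W_value_nonneg: "t \<le> horizon M \<Longrightarrow> y \<in> states M \<Longrightarrow> 0 \<le> W_value M t y"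
  by (rule nonneg_bounded_lsc_nonneg[OF nonneg_bounded_lsc_W_value])

lemma ennreal_bellman_inf_W_value:
  assumes "t < horizon M" "y \<in> states M" "a \<in> controls M"
  shows "ennreal (bellman_inf M t (W_value M (Suc t)) y a) =
    robust_step t (\<lambda>y'. ennreal (W_value M (Suc t) y')) y a"
  using assms by (intro ennreal_bellman_inf nonneg_bounded_lsc_W_value) auto

lemma bellman_inf_le_W_value:
  "t < horizon M \<Longrightarrow> a \<in> controls M \<Longrightarrow> bellman_inf M t (W_value M (Suc t)) y a \<le> W_value M t y"
  using controls_finite by (simp add: W_value_step)

lemma ex_bellman_maximizing_control:
  assumes t: "t < horizon M"
  shows "\<exists>f. control_map f \<and> (\<forall>y\<in>states M. W_value M t y = bellman_inf M t (W_value M (Suc t)) y (f y))"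
proof -
  let ?b = "\<lambda>a y. bellman_inf M t (W_value M (Suc t)) y a"
  have "?b a \<in> borel_measurable (state_space M)" if "a \<in> controls M" for a
    using nonneg_bounded_lsc_bellman_inf[OF t that nonneg_bounded_lsc_W_value[of "Suc t"]] t
    by (intro lsc_on_states_measurable) (simp add: nonneg_bounded_lsc_def)
  with controls_finite controls_nonempty
  have "\<exists>f \<in> state_space M \<rightarrow>\<^sub>M count_space (controls M).
      \<forall>y\<in>space (state_space M). ?b (f y) y = Max ((\<lambda>a. ?b a y) ` controls M)"
    by (rule ex_measurable_argmax_finite)
  then show ?thesis
    unfolding control_map_iff_count_space W_value_step[OF t] space_state_space by metis
qed

section \<open>Path laws and payoffs\<close>

abbreviation path_space :: "nat \<Rightarrow> (nat \<Rightarrow> ('n, 'd) state) measure" where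
  "path_space t \<equiv> \<Pi>\<^sub>M k\<in>{t<..horizon M}. state_space M"

definition admissible ::
  "nat \<Rightarrow> (nat \<Rightarrow> ('n, 'd) state \<Rightarrow> real^'k) \<Rightarrow> (nat \<Rightarrow> ('n, 'd) state \<Rightarrow> real^'d) \<Rightarrow> bool" where
  "admissible t \<phi> \<psi> \<longleftrightarrow> (\<forall>k\<in>{t..<horizon M}. control_map (\<phi> k) \<and> param_map (\<psi> k))"

lemma admissible_mono: "admissible s \<phi> \<psi> \<Longrightarrow> s \<le> t \<Longrightarrow> admissible t \<phi> \<psi>"
  by (simp add: admissible_def)

lemma
  assumes "admissible t \<phi> \<psi>" "t \<le> k" "k < horizon M"
  shows admissible_control_map: "control_map (\<phi> k)"
    and admissible_param_map: "param_map (\<psi> k)"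
    and admissible_control_in: "y \<in> states M \<Longrightarrow> \<phi> k y \<in> controls M"
    and admissible_param_in: "y \<in> states M \<Longrightarrow> \<psi> k y \<in> params M"
  using assms by (auto simp: admissible_def intro: control_map_in param_map_in)

lemma path_law_measurable:
  assumes "t \<le> horizon M" "admissible t \<phi> \<psi>"
  shows "path_law M t \<phi> \<psi> \<in> state_space M \<rightarrow>\<^sub>M prob_algebra (path_space t)"
  using path_steps_measurable[of t "horizon M - t" \<phi> \<psi>] assms
  by (simp add: path_law_def[abs_def] admissible_def)

lemma
  assumes "t \<le> horizon M" "admissible t \<phi> \<psi>" "y \<in> states M"
  shows prob_space_path_law: "prob_space (path_law M t \<phi> \<psi> y)"
    and sets_path_law: "sets (path_law M t \<phi> \<psi> y) = sets (path_space t)"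
  using measurable_space[OF path_law_measurable[OF assms(1,2)], of y] assms(3)
  by (auto simp: space_state_space space_prob_algebra)

lemma path_law_Suc:
  assumes "t < horizon M"
  shows "path_law M t \<phi> \<psi> y = Q_kernel M t y (\<phi> t y) (\<psi> t y) \<bind>
    (\<lambda>y'. distr (path_law M (Suc t) \<phi> \<psi> y') (path_space t) (\<lambda>\<omega>. fun_upd \<omega> (Suc t) y'))"
proof -
  have "horizon M - t = Suc (horizon M - Suc t)" "t + Suc (horizon M - Suc t) = horizon M"
    using assms by auto
  then show ?thesis
    by (simp only: path_law_def path_steps.simps)
qed

lemma measurable_path_upd:
  assumes "t < horizon M"
  shows "(\<lambda>(y', \<omega>). fun_upd \<omega> (Suc t) y') \<in> state_space M \<Otimes>\<^sub>M path_space (Suc t)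
    \<rightarrow>\<^sub>M path_space t"
  unfolding split_beta'
  by (rule measurable_fun_upd[where J = "{Suc t<..horizon M}"]) (use assms in auto)

lemma nn_integral_path_law:
  assumes t: "t < horizon M" and y: "y \<in> states M" and adm: "admissible t \<phi> \<psi>"
    and h [measurable]: "h \<in> borel_measurable (path_space t)"
  shows "(\<integral>\<^sup>+\<omega>. h \<omega> \<partial>path_law M t \<phi> \<psi> y) =
    (\<integral>\<^sup>+y'. \<integral>\<^sup>+\<omega>. h (fun_upd \<omega> (Suc t) y') \<partial>path_law M (Suc t) \<phi> \<psi> y' \<partial>Q_kernel M t y (\<phi> t y) (\<psi> t y))"
proof -
  let ?Q = "Q_kernel M t y (\<phi> t y) (\<psi> t y)"
  let ?D = "\<lambda>y'. distr (path_law M (Suc t) \<phi> \<psi> y') (path_space t) (\<lambda>\<omega>. fun_upd \<omega> (Suc t) y')"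
  note Q = t y admissible_control_in[OF adm order_refl t y] admissible_param_in[OF adm order_refl t y]
  have adm': "Suc t \<le> horizon M" "admissible (Suc t) \<phi> \<psi>"
    using t admissible_mono[OF adm] by simp_all
  note upd = measurable_path_upd[OF t]
  have "?D \<in> state_space M \<rightarrow>\<^sub>M prob_algebra (path_space t)"
    by (rule measurable_distr_prob_space2[OF path_law_measurable[OF adm'] upd])
  then have D: "?D \<in> ?Q \<rightarrow>\<^sub>M subprob_algebra (path_space t)"
    by (simp add: measurable_prob_algebraD cong: measurable_cong_sets[OF sets_Q_kernel[OF Q] refl])
  have "(\<integral>\<^sup>+\<omega>. h \<omega> \<partial>path_law M t \<phi> \<psi> y) = (\<integral>\<^sup>+y'. \<integral>\<^sup>+\<omega>. h \<omega> \<partial>?D y' \<partial>?Q)"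
    unfolding path_law_Suc[OF t] by (rule nn_integral_bind[OF h D])
  also have "\<dots> = (\<integral>\<^sup>+y'. \<integral>\<^sup>+\<omega>. h (fun_upd \<omega> (Suc t) y') \<partial>path_law M (Suc t) \<phi> \<psi> y' \<partial>?Q)"
  proof (intro nn_integral_cong nn_integral_distr h)
    fix y' assume "y' \<in> space ?Q"
    then have y': "y' \<in> states M"
      by (simp add: space_Q_kernel[OF Q])
    then show "(\<lambda>\<omega>. fun_upd \<omega> (Suc t) y') \<in>
        path_law M (Suc t) \<phi> \<psi> y' \<rightarrow>\<^sub>M path_space t"
      using measurable_compose[OF measurable_Pair1' upd] sets_path_law[OF adm' y']
      by (simp add: space_state_space cong: measurable_cong_sets)
  qed (simp add: h)
  finally show ?thesis .
qed

definition path_gain :: "(nat \<Rightarrow> ('n, 'd) state \<Rightarrow> real^'k) \<Rightarrow> nat \<Rightarrow> (nat \<Rightarrow> ('n, 'd) state) \<Rightarrow> real" where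
  "path_gain \<phi> t \<omega> =
     exp (risk M * (\<Sum>k\<in>{t<..horizon M}. discount M ^ k * reward M k (fst (\<omega> k)) (\<phi> k (\<omega> k))))"

lemma path_gain_nonneg: "0 \<le> path_gain \<phi> t \<omega>"
  by (simp add: path_gain_def)

lemma path_gain_upd:
  assumes "t < horizon M"
  shows "path_gain \<phi> t (fun_upd \<omega> (Suc t) y) = gain (Suc t) y (\<phi> (Suc t) y) * path_gain \<phi> (Suc t) \<omega>"
proof -
  have "{t<..horizon M} = insert (Suc t) {Suc t<..horizon M}"
    using assms by auto
  then have "(\<Sum>k\<in>{t<..horizon M}. discount M ^ k *
        reward M k (fst (fun_upd \<omega> (Suc t) y k)) (\<phi> k (fun_upd \<omega> (Suc t) y k))) =
      discount M ^ Suc t * reward M (Suc t) (fst y) (\<phi> (Suc t) y) +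
      (\<Sum>k\<in>{Suc t<..horizon M}. discount M ^ k * reward M k (fst (\<omega> k)) (\<phi> k (\<omega> k)))"
    by (simp del: power_Suc)
  then show ?thesis
    unfolding path_gain_def by (simp only: distrib_left exp_add mult.assoc)
qed

lemma path_gain_measurable:
  assumes "admissible t \<phi> \<psi>"
  shows "path_gain \<phi> t \<in> borel_measurable (path_space t)"
proof -
  have "(\<lambda>\<omega>. reward M k (fst (\<omega> k)) (\<phi> k (\<omega> k))) \<in> borel_measurable (path_space t)"
    if k: "k \<in> {t<..horizon M}" for k
  proof -
    have "(\<lambda>y. reward M k (fst y) (\<phi> k y)) \<in> borel_measurable (state_space M)"
      using k admissible_control_map[OF assms] by (intro reward_measurable) auto
    with measurable_component_singleton[OF k] show ?thesis
      by (rule measurable_compose)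
  qed
  then show ?thesis
    unfolding path_gain_def[abs_def] by measurable
qed

text \<open>Unlike the expectation of \<open>path_gain\<close> alone, the payoff including the stage at \<open>t\<close> satisfies
  a one-step recursion.\<close>

definition payoff ::
  "(nat \<Rightarrow> ('n, 'd) state \<Rightarrow> real^'k) \<Rightarrow> (nat \<Rightarrow> ('n, 'd) state \<Rightarrow> real^'d)
    \<Rightarrow> nat \<Rightarrow> ('n, 'd) state \<Rightarrow> ennreal" where
  "payoff \<phi> \<psi> t y =
     ennreal (gain t y (\<phi> t y)) * (\<integral>\<^sup>+\<omega>. ennreal (path_gain \<phi> t \<omega>) \<partial>path_law M t \<phi> \<psi> y)"

lemma payoff_horizon:
  assumes "y \<in> states M"
  shows "payoff \<phi> \<psi> (horizon M) y = ennreal (gain (horizon M) y a)"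
proof -
  have "prob_space (path_law M (horizon M) \<phi> \<psi> y)"
    using assms by (intro prob_space_path_law) (simp_all add: admissible_def)
  from prob_space.emeasure_space_1[OF this] show ?thesis
    by (simp add: payoff_def path_gain_def reward_def)
qed

lemma payoff_step:
  assumes t: "t < horizon M" and y: "y \<in> states M" and adm: "admissible t \<phi> \<psi>"
  shows "payoff \<phi> \<psi> t y = one_step t (payoff \<phi> \<psi> (Suc t)) y (\<phi> t y) (\<psi> t y)"
proof -
  let ?Q = "Q_kernel M t y (\<phi> t y) (\<psi> t y)"
  have adm': "Suc t \<le> horizon M" "admissible (Suc t) \<phi> \<psi>"
    using t admissible_mono[OF adm] by simp_all
  have [measurable]: "path_gain \<phi> t \<in> borel_measurable (path_space t)"
    using adm by (rule path_gain_measurable)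
  have "(\<integral>\<^sup>+\<omega>. ennreal (path_gain \<phi> t \<omega>) \<partial>path_law M t \<phi> \<psi> y) =
      (\<integral>\<^sup>+y'. \<integral>\<^sup>+\<omega>. ennreal (path_gain \<phi> t (fun_upd \<omega> (Suc t) y')) \<partial>path_law M (Suc t) \<phi> \<psi> y' \<partial>?Q)"
    by (intro nn_integral_path_law t y adm) measurable
  also have "\<dots> = (\<integral>\<^sup>+y'. payoff \<phi> \<psi> (Suc t) y' \<partial>?Q)"
  proof (rule nn_integral_cong)
    fix y' assume "y' \<in> space ?Q"
    then have "y' \<in> states M"
      using space_Q_kernel[OF t y admissible_control_in[OF adm order_refl t y]
          admissible_param_in[OF adm order_refl t y]] by simp
    then have [measurable_cong]:
      "sets (path_law M (Suc t) \<phi> \<psi> y') = sets (path_space (Suc t))"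
      by (rule sets_path_law[OF adm'])
    have [measurable]: "path_gain \<phi> (Suc t) \<in> borel_measurable (path_space (Suc t))"
      using adm'(2) by (rule path_gain_measurable)
    show "(\<integral>\<^sup>+\<omega>. ennreal (path_gain \<phi> t (fun_upd \<omega> (Suc t) y')) \<partial>path_law M (Suc t) \<phi> \<psi> y') =
        payoff \<phi> \<psi> (Suc t) y'"
      unfolding path_gain_upd[OF t] ennreal_mult''[OF path_gain_nonneg] payoff_def
      by (intro nn_integral_cmult) measurable
  qed
  finally show ?thesis
    by (simp add: payoff_def[of _ _ t] one_step_def)
qed

lemma comparison_principle:
  assumes "t \<le> horizon M" "admissible t \<phi> \<psi>" "y \<in> states M"
    and "\<And>y. y \<in> states M \<Longrightarrow> v (horizon M) y \<le> w (horizon M) y"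
    and "\<And>k y. t \<le> k \<Longrightarrow> k < horizon M \<Longrightarrow> y \<in> states M \<Longrightarrow>
      v k y \<le> one_step k (v (Suc k)) y (\<phi> k y) (\<psi> k y)"
    and "\<And>k y. t \<le> k \<Longrightarrow> k < horizon M \<Longrightarrow> y \<in> states M \<Longrightarrow>
      one_step k (w (Suc k)) y (\<phi> k y) (\<psi> k y) \<le> w k y"
  shows "v t y \<le> w t y"
  using assms
proof (induction t arbitrary: y rule: inc_induct)
  case (step t)
  note t = step.hyps(2) and adm = step.prems(1) and y = step.prems(2)
  have IH: "v (Suc t) y' \<le> w (Suc t) y'" if "y' \<in> states M" for y'
    using step.prems that by (intro step.IH) (simp_all add: admissible_mono[OF adm])
  have "v t y \<le> one_step t (v (Suc t)) y (\<phi> t y) (\<psi> t y)"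
    using t y by (intro step.prems(4)) simp_all
  also have "\<dots> \<le> one_step t (w (Suc t)) y (\<phi> t y) (\<psi> t y)"
    by (intro one_step_mono t y IH admissible_control_in[OF adm] admissible_param_in[OF adm] order_refl)
  also have "\<dots> \<le> w t y"
    using t y by (intro step.prems(5)) simp_all
  finally show ?case .
qed simp

lemma payoff_finite:
  assumes t: "t \<le> horizon M" and adm: "admissible t \<phi> \<psi>" and y: "y \<in> states M"
  shows "payoff \<phi> \<psi> t y < top"
proof -
  obtain c where gain_le: "\<And>k y a. k \<le> horizon M \<Longrightarrow> feasible k a \<Longrightarrow> gain k y a \<le> c k"
    using gain_bounded_above by metis
  let ?w = "\<lambda>k (_ :: ('n, 'd) state). \<Prod>j\<in>{k..horizon M}. ennreal (c j)"
  have "payoff \<phi> \<psi> t y \<le> ?w t y"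
  proof (rule comparison_principle[OF t adm y])
    fix y assume "y \<in> states M"
    then show "payoff \<phi> \<psi> (horizon M) y \<le> ?w (horizon M) y"
      using gain_le[of "horizon M"] by (simp add: payoff_horizon[where a = undefined] ennreal_leI)
  next
    fix k y assume k: "t \<le> k" "k < horizon M" and y: "y \<in> states M"
    show "payoff \<phi> \<psi> k y \<le> one_step k (payoff \<phi> \<psi> (Suc k)) y (\<phi> k y) (\<psi> k y)"
      by (intro eq_refl payoff_step k(2) y admissible_mono[OF adm k(1)])
    have a: "\<phi> k y \<in> controls M" and \<theta>: "\<psi> k y \<in> params M"
      using adm k y by (rule admissible_control_in admissible_param_in)+
    have "one_step k (?w (Suc k)) y (\<phi> k y) (\<psi> k y) = ennreal (gain k y (\<phi> k y)) * ?w (Suc k) y"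
      by (rule one_step_const[OF k(2) y a \<theta>])
    also have "\<dots> \<le> ennreal (c k) * ?w (Suc k) y"
      using a k(2) by (intro mult_right_mono ennreal_leI gain_le) simp_all
    also have "\<dots> = ?w k y"
      using k(2) by (simp add: prod.atLeast_Suc_atMost)
    finally show "one_step k (?w (Suc k)) y (\<phi> k y) (\<psi> k y) \<le> ?w k y" .
  qed
  also have "\<dots> < top"
    unfolding less_top[symmetric] by (simp add: ennreal_prod_eq_top)
  finally show ?thesis .
qed

section \<open>The robust value of a control strategy\<close>

lemma admissible_strategies:
  "\<phi> \<in> control_strategies M t \<Longrightarrow> \<psi> \<in> nature_strategies M t \<Longrightarrow> admissible t \<phi> \<psi>"
  by (simp add: admissible_def control_strategies_def nature_strategies_def PiE_iff)

lemma nature_strategies_in_region: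
  assumes "\<psi> \<in> nature_strategies M t" "t \<le> k" "k < horizon M" "y \<in> states M"
  shows "\<psi> k y \<in> region M k (snd y)"
  using assms by (cases y) (force simp: nature_strategies_def)

lemma ex_worst_response:
  assumes \<phi>: "\<phi> \<in> control_strategies M t"
    and h: "\<And>k. k < horizon M \<Longrightarrow> lsc_on (states M) (h k)"
  shows "\<exists>\<psi>\<in>nature_strategies M t. \<forall>k\<in>{t..<horizon M}. \<forall>y\<in>states M.
    one_step k (h k) y (\<phi> k y) (\<psi> k y) = robust_step k (h k) y (\<phi> k y)"
proof -
  have "\<forall>k\<in>{t..<horizon M}. \<exists>g. param_map g \<and> (\<forall>y\<in>states M. g y \<in> region M k (snd y) \<and>
      one_step k (h k) y (\<phi> k y) (g y) = robust_step k (h k) y (\<phi> k y))"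
    using \<phi> by (intro ballI ex_worst_parameter h) (auto simp: control_strategies_def)
  then obtain g where g: "\<And>k. k \<in> {t..<horizon M} \<Longrightarrow> param_map (g k)"
    "\<And>k y. k \<in> {t..<horizon M} \<Longrightarrow> y \<in> states M \<Longrightarrow> g k y \<in> region M k (snd y)"
    "\<And>k y. k \<in> {t..<horizon M} \<Longrightarrow> y \<in> states M \<Longrightarrow>
      one_step k (h k) y (\<phi> k y) (g k y) = robust_step k (h k) y (\<phi> k y)"
    by metis
  have "restrict g {t..<horizon M} \<in> nature_strategies M t"
    using g(1,2) by (fastforce simp: nature_strategies_def)
  with g(3) show ?thesis
    by (intro bexI[of _ "restrict g {t..<horizon M}"]) simp_all
qed

lemma ex_nature_strategy_payoff_le_W_value:
  assumes t: "t \<le> horizon M" and \<phi>: "\<phi> \<in> control_strategies M t"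
  shows "\<exists>\<psi>\<in>nature_strategies M t. \<forall>y\<in>states M. payoff \<phi> \<psi> t y \<le> ennreal (W_value M t y)"
proof -
  let ?W = "\<lambda>k y. ennreal (W_value M k y)"
  have "lsc_on (states M) (?W (Suc k))" if "k < horizon M" for k
    using that by (intro nonneg_bounded_lsc_imp_lsc_on_ennreal nonneg_bounded_lsc_W_value) simp
  from ex_worst_response[where h = "\<lambda>k. ?W (Suc k)", OF \<phi> this]
  obtain \<psi> where \<psi>: "\<psi> \<in> nature_strategies M t"
    and worst: "\<And>k y. k \<in> {t..<horizon M} \<Longrightarrow> y \<in> states M \<Longrightarrow>
      one_step k (?W (Suc k)) y (\<phi> k y) (\<psi> k y) = robust_step k (?W (Suc k)) y (\<phi> k y)"
    by blast
  note adm = admissible_strategies[OF \<phi> \<psi>]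
  have "payoff \<phi> \<psi> t y \<le> ?W t y" if y: "y \<in> states M" for y
  proof (rule comparison_principle[where w = ?W, OF t adm y])
    fix y assume "y \<in> states M"
    then show "payoff \<phi> \<psi> (horizon M) y \<le> ?W (horizon M) y"
      by (simp add: payoff_horizon[where a = undefined] W_value_horizon[where a = undefined])
  next
    fix k y assume k: "t \<le> k" "k < horizon M" and y: "y \<in> states M"
    show "payoff \<phi> \<psi> k y \<le> one_step k (payoff \<phi> \<psi> (Suc k)) y (\<phi> k y) (\<psi> k y)"
      by (intro eq_refl payoff_step k(2) y admissible_mono[OF adm k(1)])
    have a: "\<phi> k y \<in> controls M"
      using adm k y by (rule admissible_control_in)
    have "one_step k (?W (Suc k)) y (\<phi> k y) (\<psi> k y) =
        ennreal (bellman_inf M k (W_value M (Suc k)) y (\<phi> k y))"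
      using k worst[OF _ y] by (simp add: ennreal_bellman_inf_W_value[OF k(2) y a])
    also have "\<dots> \<le> ?W k y"
      by (intro ennreal_leI bellman_inf_le_W_value k(2) a)
    finally show "one_step k (?W (Suc k)) y (\<phi> k y) (\<psi> k y) \<le> ?W k y" .
  qed
  with \<psi> show ?thesis
    by blast
qed

definition bellman_maximizing :: "nat \<Rightarrow> (nat \<Rightarrow> ('n, 'd) state \<Rightarrow> real^'k) \<Rightarrow> bool" where
  "bellman_maximizing t \<phi> \<longleftrightarrow> (\<forall>k\<in>{t..<horizon M}. \<forall>y\<in>states M.
     W_value M k y = bellman_inf M k (W_value M (Suc k)) y (\<phi> k y))"

lemma W_value_le_payoff:
  assumes t: "t \<le> horizon M" and y: "y \<in> states M"
    and \<phi>: "\<phi> \<in> control_strategies M t" "bellman_maximizing t \<phi>" and \<psi>: "\<psi> \<in> nature_strategies M t"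
  shows "ennreal (W_value M t y) \<le> payoff \<phi> \<psi> t y"
proof -
  let ?W = "\<lambda>k y. ennreal (W_value M k y)"
  note adm = admissible_strategies[OF \<phi>(1) \<psi>]
  show "?W t y \<le> payoff \<phi> \<psi> t y"
  proof (rule comparison_principle[where v = ?W, OF t adm y])
    fix y assume "y \<in> states M"
    then show "?W (horizon M) y \<le> payoff \<phi> \<psi> (horizon M) y"
      by (simp add: payoff_horizon[where a = undefined] W_value_horizon[where a = undefined])
  next
    fix k y assume k: "t \<le> k" "k < horizon M" and y: "y \<in> states M"
    show "one_step k (payoff \<phi> \<psi> (Suc k)) y (\<phi> k y) (\<psi> k y) \<le> payoff \<phi> \<psi> k y"
      by (intro eq_refl payoff_step[symmetric] k(2) y admissible_mono[OF adm k(1)])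
    have "?W k y = ennreal (bellman_inf M k (W_value M (Suc k)) y (\<phi> k y))"
      using \<phi>(2) k y by (simp add: bellman_maximizing_def)
    also have "\<dots> = robust_step k (?W (Suc k)) y (\<phi> k y)"
      by (rule ennreal_bellman_inf_W_value[OF k(2) y admissible_control_in[OF adm k y]])
    also have "\<dots> \<le> one_step k (?W (Suc k)) y (\<phi> k y) (\<psi> k y)"
      unfolding robust_step_def by (intro INF_lower nature_strategies_in_region[OF \<psi> k y])
    finally show "?W k y \<le> one_step k (?W (Suc k)) y (\<phi> k y) (\<psi> k y)" .
  qed
qed

lemma ennreal_payoff_integral:
  assumes "t \<le> horizon M" "y \<in> states M" and adm: "admissible t \<phi> \<psi>"
  shows "ennreal (gain t y (\<phi> t y)) * ennreal (\<integral>\<omega>. path_gain \<phi> t \<omega> \<partial>path_law M t \<phi> \<psi> y) =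
    payoff \<phi> \<psi> t y"
proof -
  have "(\<integral>\<^sup>+\<omega>. ennreal (path_gain \<phi> t \<omega>) \<partial>path_law M t \<phi> \<psi> y) < top"
    using payoff_finite[OF assms(1,3,2)] by (auto simp: payoff_def ennreal_mult_less_top)
  moreover have "path_gain \<phi> t \<in> borel_measurable (path_law M t \<phi> \<psi> y)"
    using path_gain_measurable[OF adm] sets_path_law[OF assms(1,3,2)]
    by (simp cong: measurable_cong_sets)
  ultimately have "ennreal (\<integral>\<omega>. path_gain \<phi> t \<omega> \<partial>path_law M t \<phi> \<psi> y) =
      (\<integral>\<^sup>+\<omega>. ennreal (path_gain \<phi> t \<omega>) \<partial>path_law M t \<phi> \<psi> y)"
    by (simp add: integral_eq_nn_integral path_gain_nonneg)
  then show ?thesis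
    by (simp add: payoff_def)
qed

lemma
  assumes t: "t \<le> horizon M" and y: "y \<in> states M" and \<phi>: "\<phi> \<in> control_strategies M t"
  shows U_value_nonneg: "0 \<le> U_value M t \<phi> y"
    and ennreal_U_value: "ennreal (U_value M t \<phi> y) = (INF \<psi>\<in>nature_strategies M t. payoff \<phi> \<psi> t y)"
proof -
  let ?E = "\<lambda>\<psi>. \<integral>\<omega>. path_gain \<phi> t \<omega> \<partial>path_law M t \<phi> \<psi> y"
  have nonempty: "nature_strategies M t \<noteq> {}"
    using ex_nature_strategy_payoff_le_W_value[OF t \<phi>] by blast
  have U_eq: "U_value M t \<phi> y = gain t y (\<phi> t y) * (INF \<psi>\<in>nature_strategies M t. ?E \<psi>)"
    by (simp add: U_value_def path_laws_def path_gain_def image_image)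
  have E_nonneg: "0 \<le> ?E \<psi>" for \<psi>
    by (intro Bochner_Integration.integral_nonneg path_gain_nonneg)
  with nonempty show "0 \<le> U_value M t \<phi> y"
    unfolding U_eq by (intro mult_nonneg_nonneg cINF_greatest) auto
  have "ennreal (U_value M t \<phi> y) =
      ennreal (gain t y (\<phi> t y)) * (INF \<psi>\<in>nature_strategies M t. ennreal (?E \<psi>))"
    unfolding U_eq using nonempty E_nonneg
    by (subst ennreal_cINF[symmetric]) (auto simp: ennreal_mult' intro!: bdd_belowI[of _ 0])
  also have "\<dots> = (INF \<psi>\<in>nature_strategies M t. ennreal (gain t y (\<phi> t y)) * ennreal (?E \<psi>))"
    using nonempty by (intro INF_mult_left_ennreal) simp_all
  also have "\<dots> = (INF \<psi>\<in>nature_strategies M t. payoff \<phi> \<psi> t y)"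
    by (intro INF_cong refl ennreal_payoff_integral t y admissible_strategies \<phi>)
  finally show "ennreal (U_value M t \<phi> y) = (INF \<psi>\<in>nature_strategies M t. payoff \<phi> \<psi> t y)" .
qed

lemma U_value_le_W_value:
  assumes t: "t \<le> horizon M" and y: "y \<in> states M" and \<phi>: "\<phi> \<in> control_strategies M t"
  shows "U_value M t \<phi> y \<le> W_value M t y"
proof -
  have "ennreal (U_value M t \<phi> y) \<le> ennreal (W_value M t y)"
    unfolding ennreal_U_value[OF assms]
    using ex_nature_strategy_payoff_le_W_value[OF t \<phi>] y by (blast intro: INF_lower2)
  then show ?thesis
    using W_value_nonneg[OF t y] by simp
qed

lemma U_value_eq_W_value:
  assumes t: "t \<le> horizon M" and y: "y \<in> states M"
    and \<phi>: "\<phi> \<in> control_strategies M t" "bellman_maximizing t \<phi>"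
  shows "U_value M t \<phi> y = W_value M t y"
proof (rule antisym[OF U_value_le_W_value[OF t y \<phi>(1)]])
  have "ennreal (W_value M t y) \<le> ennreal (U_value M t \<phi> y)"
    unfolding ennreal_U_value[OF t y \<phi>(1)] by (intro INF_greatest W_value_le_payoff t y \<phi>)
  then show "W_value M t y \<le> U_value M t \<phi> y"
    using U_value_nonneg[OF t y \<phi>(1)] by simp
qed

lemma ex_bellman_maximizing:
  "\<exists>\<phi>\<in>control_strategies M t. bellman_maximizing t \<phi>"
proof -
  obtain f where f: "\<And>k. k < horizon M \<Longrightarrow> control_map (f k)"
    "\<And>k y. k < horizon M \<Longrightarrow> y \<in> states M \<Longrightarrow>
      W_value M k y = bellman_inf M k (W_value M (Suc k)) y (f k y)"
    using ex_bellman_maximizing_control by metis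
  then have "restrict f {t..<horizon M} \<in> control_strategies M t"
    "bellman_maximizing t (restrict f {t..<horizon M})"
    by (auto simp: control_strategies_def bellman_maximizing_def)
  then show ?thesis
    by blast
qed

lemma U_opt_eq_W_value:
  assumes t: "t \<le> horizon M" and y: "y \<in> states M"
  shows "U_opt M t y = W_value M t y"
proof (cases "t < horizon M")
  case True
  obtain \<phi> where \<phi>: "\<phi> \<in> control_strategies M t" "bellman_maximizing t \<phi>"
    using ex_bellman_maximizing by blast
  have "(SUP \<phi>\<in>control_strategies M t. U_value M t \<phi> y) = W_value M t y"
  proof (rule cSup_eq_maximum)
    show "W_value M t y \<in> (\<lambda>\<phi>. U_value M t \<phi> y) ` control_strategies M t"
      using U_value_eq_W_value[OF t y \<phi>] \<phi>(1) by (metis imageI)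
  qed (use U_value_le_W_value[OF t y] in blast)
  with True show ?thesis
    by (simp add: U_opt_def)
next
  case False
  then show ?thesis
    by (simp add: U_opt_def W_value.simps[of M t])
qed

lemma U_opt_eq_U_value:
  assumes t: "t \<le> horizon M" and y: "y \<in> states M"
    and \<phi>: "\<phi> \<in> control_strategies M s" "bellman_maximizing s \<phi>" "s \<le> t"
  shows "U_opt M t y = U_value M t (restrict \<phi> {t..<horizon M}) y"
proof -
  have "restrict \<phi> {t..<horizon M} \<in> control_strategies M t"
    "bellman_maximizing t (restrict \<phi> {t..<horizon M})"
    using \<phi> by (auto simp: control_strategies_def bellman_maximizing_def PiE_iff)
  then show ?thesis
    using U_opt_eq_W_value[OF t y] U_value_eq_W_value[OF t y] by simp
qed

end

theorem theorem3p5: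
  fixes M :: "('n::finite, 'd::finite, 'k::finite, 'm::finite, 'w) robust_model"
  assumes "adaptive_robust M"
  shows "(\<forall>t\<le>horizon M. \<forall>y\<in>states M. U_opt M t y = W_value M t y) \<and>
    (\<forall>\<phi>\<in>control_strategies M 0.
       (\<forall>t<horizon M. \<forall>y\<in>states M.
          W_value M t y = bellman_inf M t (W_value M (Suc t)) y (\<phi> t y)) \<longrightarrow>
       (\<forall>t<horizon M. \<forall>y\<in>states M.
          U_opt M t y = U_value M t (restrict \<phi> {t..<horizon M}) y))"
proof -
  interpret adaptive_robust M
    by (rule assms)
  show ?thesis
  proof (intro conjI allI ballI impI)
    fix \<phi> t y
    assume \<phi>: "\<phi> \<in> control_strategies M 0" and t: "t < horizon M" and y: "y \<in> states M"
      and "\<forall>t<horizon M. \<forall>y\<in>states M. W_value M t y = bellman_inf M t (W_value M (Suc t)) y (\<phi> t y)"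
    then have "bellman_maximizing 0 \<phi>"
      by (simp add: bellman_maximizing_def)
    then show "U_opt M t y = U_value M t (restrict \<phi> {t..<horizon M}) y"
      by (rule U_opt_eq_U_value[OF less_imp_le[OF t] y \<phi> _ le0])
  qed (rule U_opt_eq_W_value)
qed

end
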